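(* Let $0<\nu<\lambda<\infty$ and $x,y\in[-1,1]$. For $r\in(-1,1)$, the sum of the Askey-Fitch series $$\sum_{n=0}^{\infty}\omega_n^{\nu}\,r^n\,W_n^{\lambda}(x)\,W_n^{\nu}(y)$$ is given by the integral $$\int_0^1 H_{\nu}^{\lambda}(du)\int_{-1}^1 G_{\nu-\frac12}(dv)\,\frac{\left[1-r^2\,(x^2-x^2u^2+u^2)\right]}{I^{\nu+1}},$$ where $I$ is given by $$I:=1-2r\cdot\frac{xy+uv\sqrt{1-x^2}\sqrt{1-y^2}}{\sqrt{x^2-x^2u^2+u^2}}+\frac{\left(xy+uv\sqrt{1-x^2}\sqrt{1-y^2}\right)^2}{x^2-x^2u^2+u^2}.$$ Moreover, for $x,y\in(-1,1)$ this holds also for $r=1$ unless $\nu<\lambda\le\nu+1$.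
   Context: For $\nu>0$ and $n=0,1,2,\dots$, $W_n^{\nu}$ denotes the ultraspherical (Gegenbauer) polynomial of degree $n$ and index $\nu$, normalised so that $W_n^{\nu}(1)=1$. The weights are $$\omega_n^{\nu}=\frac{n+\nu}{\nu}\,\frac{\Gamma(n+2\nu)}{n!\,\Gamma(2\nu)}.$$ For $\kappa>-\frac12$, $G_{\kappa}$ is the probability measure on $[-1,1]$ given by $$G_{\kappa}(dy)=\frac{\Gamma(\kappa+1)}{\sqrt{\pi}\,\Gamma(\kappa+\frac12)}(1-y^2)^{\kappa-\frac12}\,dy;$$ the measure $G_{\nu-\frac12}$ is the case $\kappa=\nu-\frac12$. For $\lambda>\nu>0$, $H_{\nu}^{\lambda}$ is the probability measure of Beta type on $[0,1]$ (the Sonine law) given by $$H_{\nu}^{\lambda}(du)=\frac{2\,\Gamma(\lambda+\frac12)}{\Gamma(\nu+\frac12)\,\Gamma(\lambda-\nu)}\,u^{2\nu}(1-u^2)^{\lambda-\nu-1}\,du.$$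
   Formalization: The printed I is false (r=0, x=y=0: the series is 1, the integral is <1); it is replaced by I = 1 − 2r(xy+uv√(1−x²)√(1−y²)) + r²(x²−x²u²+u²), the Poisson-kernel denominator matching the stated numerator. *)

theory Defs
  imports "HOL-Analysis.Analysis" "HOL-Computational_Algebra.Polynomial"
begin

text \<open>
  The Gegenbauer polynomials in the classical normalisation, where the value at 1 is
  \<open>\<Gamma>(n + 2\<nu>) / (n! \<Gamma>(2\<nu>))\<close>, given by the three-term recurrence
  \<open>(n + 2) C\<^sub>n\<^sub>+\<^sub>2 = 2 (n + 1 + \<nu>) x C\<^sub>n\<^sub>+\<^sub>1 - (n + 2\<nu>) C\<^sub>n\<close>.
\<close>

fun gegenbauer_poly :: "real \<Rightarrow> nat \<Rightarrow> real poly" where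
  "gegenbauer_poly \<nu> 0 = 1"
| "gegenbauer_poly \<nu> (Suc 0) = [:0, 2 * \<nu>:]"
| "gegenbauer_poly \<nu> (Suc (Suc n)) =
     smult (1 / (real n + 2))
       ([:0, 2 * (real n + 1 + \<nu>):] * gegenbauer_poly \<nu> (Suc n)
        - smult (real n + 2 * \<nu>) (gegenbauer_poly \<nu> n))"

definition ultraspherical :: "real \<Rightarrow> nat \<Rightarrow> real \<Rightarrow> real" where
  "ultraspherical \<nu> n x = poly (gegenbauer_poly \<nu> n) x / poly (gegenbauer_poly \<nu> n) 1"

lemma poly_gegenbauer_1: "poly (gegenbauer_poly \<nu> n) 1 = pochhammer (2 * \<nu>) n / fact n"
proof (induction \<nu> n rule: gegenbauer_poly.induct)
  case (3 \<nu> n)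
  define p where "p = pochhammer (2 * \<nu>) n"
  define f :: real where "f = fact n"
  define m where "m = real n"
  have nz: "f \<noteq> 0" "m + 1 \<noteq> 0" "m + 2 \<noteq> 0"
    by (auto simp: f_def m_def)
  have "1 / (m + 2) * (2 * (m + 1 + \<nu>) * (p * (2 * \<nu> + m) / ((m + 1) * f)) - (m + 2 * \<nu>) * (p / f))
          = p * (2 * \<nu> + m) * (2 * \<nu> + (m + 1)) / ((m + 2) * ((m + 1) * f))"
    using nz by (simp add: divide_simps) algebra
  then show ?case
    using 3 by (simp add: pochhammer_Suc p_def f_def m_def algebra_simps)
qed simp_all

lemma ultraspherical_1: "\<nu> > 0 \<Longrightarrow> ultraspherical \<nu> n 1 = 1"
  using pochhammer_pos[of "2 * \<nu>" n]
  by (simp add: ultraspherical_def poly_gegenbauer_1)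

lemma degree_gegenbauer_poly:
  assumes "\<nu> > 0"
  shows "degree (gegenbauer_poly \<nu> n) = n"
proof -
  have "degree (gegenbauer_poly \<nu> n) \<le> n \<and> coeff (gegenbauer_poly \<nu> n) n > 0"
    using assms
  proof (induction \<nu> n rule: gegenbauer_poly.induct)
    case (3 \<nu> n)
    then have d: "degree (gegenbauer_poly \<nu> (Suc n)) \<le> Suc n" "degree (gegenbauer_poly \<nu> n) \<le> n"
      and c: "coeff (gegenbauer_poly \<nu> (Suc n)) (Suc n) > 0" by auto
    have "coeff (gegenbauer_poly \<nu> n) (Suc (Suc n)) = 0"
      using d(2) by (intro coeff_eq_0) simp
    then have 1: "coeff (gegenbauer_poly \<nu> (Suc (Suc n))) (Suc (Suc n)) > 0"
      using c "3.prems" by simp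
    have "degree ([:0, 2 * (real n + 1 + \<nu>):] * gegenbauer_poly \<nu> (Suc n)) \<le> Suc (Suc n)"
      using degree_mult_le[of "[:0, 2 * (real n + 1 + \<nu>):]" "gegenbauer_poly \<nu> (Suc n)"] d(1)
      by (auto split: if_splits)
    then have "degree (gegenbauer_poly \<nu> (Suc (Suc n))) \<le> Suc (Suc n)"
      unfolding gegenbauer_poly.simps
      using d(2) by (intro order.trans[OF degree_smult_le] degree_diff_le) auto
    with 1 show ?case by blast
  qed auto
  then show ?thesis
    by (metis le_antisym le_degree less_irrefl)
qed

definition gegenbauer_weight :: "real \<Rightarrow> nat \<Rightarrow> real" where
  "gegenbauer_weight \<nu> n =
     (real n + \<nu>) / \<nu> * (Gamma (real n + 2 * \<nu>) / (fact n * Gamma (2 * \<nu>)))"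

definition gegenbauer_measure :: "real \<Rightarrow> real measure" where
  "gegenbauer_measure \<kappa> = density lborel (\<lambda>v. ennreal (indicator {-1..1} v *
     (Gamma (\<kappa> + 1) / (sqrt pi * Gamma (\<kappa> + 1/2)) * (1 - v\<^sup>2) powr (\<kappa> - 1/2))))"

definition sonine_measure :: "real \<Rightarrow> real \<Rightarrow> real measure" where
  "sonine_measure \<nu> lam = density lborel (\<lambda>u. ennreal (indicator {0..1} u *
     (2 * Gamma (lam + 1/2) / (Gamma (\<nu> + 1/2) * Gamma (lam - \<nu>)) *
      u powr (2 * \<nu>) * (1 - u\<^sup>2) powr (lam - \<nu> - 1))))"

text \<open>
  With \<open>\<rho>\<^sup>2 = x\<^sup>2 - x\<^sup>2u\<^sup>2 + u\<^sup>2\<close> and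
  \<open>\<zeta> = (xy + uv \<surd>(1 - x\<^sup>2) \<surd>(1 - y\<^sup>2)) / \<rho>\<close>, the denominator base is
  \<open>I = 1 - 2(r\<rho>)\<zeta> + (r\<rho>)\<^sup>2\<close>, the one of the Poisson kernel
  \<open>\<Sum>n. \<omega>\<^sub>n (r\<rho>)\<^sup>n W\<^sub>n(\<zeta>) = (1 - (r\<rho>)\<^sup>2) / I powr (\<nu> + 1)\<close>.
  The formula \<open>1 - 2r\<zeta> + \<zeta>\<^sup>2\<close> printed in the source for \<open>I\<close> is a misprint:
  for \<open>r = 0\<close>, \<open>x = y = 0\<close> the series is 1, while the printed integral is that of
  \<open>1 / (1 + v\<^sup>2) powr (\<nu> + 1)\<close> against probability measures, which is less than 1.
\<close>

definition askey_fitch_I :: "real \<Rightarrow> real \<Rightarrow> real \<Rightarrow> real \<Rightarrow> real \<Rightarrow> real" where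
  "askey_fitch_I x y r u v =
     1 - 2 * r * (x * y + u * v * sqrt (1 - x\<^sup>2) * sqrt (1 - y\<^sup>2))
       + r\<^sup>2 * (x\<^sup>2 - x\<^sup>2 * u\<^sup>2 + u\<^sup>2)"

definition askey_fitch_integrand ::
  "real \<Rightarrow> real \<Rightarrow> real \<Rightarrow> real \<Rightarrow> real \<Rightarrow> real \<Rightarrow> real" where
  "askey_fitch_integrand \<nu> x y r u v =
     (1 - r\<^sup>2 * (x\<^sup>2 - x\<^sup>2 * u\<^sup>2 + u\<^sup>2)) / askey_fitch_I x y r u v powr (\<nu> + 1)"

end

theory Submission
  imports Defs "HOL-Probability.Probability_Measure" "HOL-Real_Asymp.Real_Asymp"
begin

text \<open>
  The integrand is a Poisson kernel in disguise. Put
  \<open>\<rho>\<^sup>2 = x\<^sup>2 - x\<^sup>2u\<^sup>2 + u\<^sup>2\<close>. Then \<open>\<rho>\<^sup>2 - x\<^sup>2 = u\<^sup>2 (1 - x\<^sup>2)\<close>, so with \<open>X = x / \<rho>\<close> the point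
  \<open>\<zeta> = X y + v \<surd>(1 - X\<^sup>2) \<surd>(1 - y\<^sup>2)\<close> lies in \<open>[-1, 1]\<close> and the integrand is
  \<open>(1 - (r\<rho>)\<^sup>2) / (1 - 2 (r\<rho>) \<zeta> + (r\<rho>)\<^sup>2) powr (\<nu> + 1) = \<Sum>n. \<omega>\<^sub>n (r\<rho>)\<^sup>n W\<^sub>n\<^sup>\<nu>(\<zeta>)\<close>
  (\<open>ultraspherical_poisson_kernel\<close>). Two integral identities then evaluate each term:
  averaging over \<open>v\<close> turns \<open>W\<^sub>n\<^sup>\<nu>(\<zeta>)\<close> into \<open>W\<^sub>n\<^sup>\<nu>(X) W\<^sub>n\<^sup>\<nu>(y)\<close>
  (\<open>ultraspherical_product_formula\<close>), and averaging over \<open>u\<close> turns \<open>\<rho>\<^sup>n W\<^sub>n\<^sup>\<nu>(x / \<rho>)\<close> into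
  \<open>W\<^sub>n\<^sup>\<lambda>(x)\<close> (\<open>sonine_integral\<close>). For \<open>\<bar>r\<bar> < 1\<close> sums and integrals may be exchanged, because
  \<open>\<bar>W\<^sub>n\<^sup>\<nu>\<bar> \<le> 1\<close> on \<open>[-1, 1]\<close> and \<open>\<Sum>n. \<omega>\<^sub>n \<bar>r\<bar>\<^sup>n\<close> converges.

  All polynomial identities come from three-term recurrences. The product formula is an induction
  on the degree, for all indices at once: the recurrence for \<open>W\<^sub>n\<^sup>\<nu>(\<zeta>)\<close> produces an integral
  with an extra factor \<open>v\<close>, which integration by parts turns into an integral of the same kind for
  index \<open>\<nu> + 1\<close> and a lower degree. Sonine's integral is a comparison of the coefficients in
  \<open>W\<^sub>n\<^sup>\<nu>(x) = \<Sum>k. c\<^sub>n\<^sub>k x\<^bsup>n - 2k\<^esup> (1 - x\<^sup>2)\<^bsup>k\<^esup> / (\<nu> + 1/2)\<^sub>k\<close>, where only the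
  last factor depends on the index, with the moments \<open>(\<nu> + 1/2)\<^sub>k / (\<lambda> + 1/2)\<^sub>k\<close> of the Sonine law.

  For \<open>r = 1\<close> and \<open>\<lambda> > \<nu> + 1\<close>, let \<open>r\<close> increase to 1. On the series side, an energy estimate for
  the recurrence gives the decay \<open>W\<^sub>n\<^sup>\<lambda>(x) = O(n\<^bsup>-\<lambda>\<^esup>)\<close> inside the interval, so that the terms
  are \<open>O(n\<^bsup>\<nu> - \<lambda>\<^esup>)\<close> and the series converges absolutely. On the integral side, the denominator
  base \<open>I\<close> is bounded below both by a multiple of \<open>(1 - u\<^sup>2)\<^sup>2\<close> and by a multiple of
  \<open>u (1 - v\<^sup>2)\<close>, uniformly in \<open>r \<ge> 1/2\<close>. Sharing the exponent between the two bounds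
  gives an integrable majorant that is a product of a function of \<open>u\<close> and a function of \<open>v\<close>
  (\<open>askey_fitch_majorant\<close>), and dominated convergence applies.
\<close>

section \<open>Recurrence and derivative of the Gegenbauer polynomials\<close>

definition gegenbauer :: "real \<Rightarrow> nat \<Rightarrow> real \<Rightarrow> real" where
  "gegenbauer \<nu> n x = poly (gegenbauer_poly \<nu> n) x"

lemma gegenbauer_0 [simp]: "gegenbauer \<nu> 0 x = 1"
  and gegenbauer_1 [simp]: "gegenbauer \<nu> (Suc 0) x = 2 * \<nu> * x"
  by (simp_all add: gegenbauer_def)

lemma gegenbauer_rec:
  "(real n + 2) * gegenbauer \<nu> (Suc (Suc n)) x =
     2 * (real n + 1 + \<nu>) * x * gegenbauer \<nu> (Suc n) x - (real n + 2 * \<nu>) * gegenbauer \<nu> n x"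
  by (simp add: gegenbauer_def field_simps)

text \<open>
  This expresses \<open>C\<^sub>n\<^sup>\<nu>\<close> through polynomials of index \<open>\<nu> + 1\<close>, the index of the
  derivative; both sides obey the recurrence of index \<open>\<nu>\<close> once the products \<open>x B\<^sub>k\<close> are
  eliminated by the recurrence of index \<open>\<nu> + 1\<close>.
\<close>

lemma gegenbauer_index_shift:
  assumes "\<nu> > 0"
  shows "(real n + 2 + \<nu>) * gegenbauer \<nu> (Suc (Suc n)) x =
     \<nu> * (gegenbauer (\<nu> + 1) (Suc (Suc n)) x - gegenbauer (\<nu> + 1) n x)"
proof (induction n rule: induct_nat_012)
  case 0
  show ?case by (simp add: gegenbauer_def field_simps)
next
  case 1
  show ?case by (simp add: gegenbauer_def field_simps)
next
  case (ge2 n)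
  define m where "m = real n"
  have m: "m \<ge> 0" by (simp add: m_def)
  define B0 B1 B2 B3 B4 where "B0 = gegenbauer (\<nu> + 1) n x" and "B1 = gegenbauer (\<nu> + 1) (Suc n) x"
    and "B2 = gegenbauer (\<nu> + 1) (Suc (Suc n)) x" and "B3 = gegenbauer (\<nu> + 1) (Suc (Suc (Suc n))) x"
    and "B4 = gegenbauer (\<nu> + 1) (Suc (Suc (Suc (Suc n)))) x"
  define C2 C3 C4 where "C2 = gegenbauer \<nu> (Suc (Suc n)) x" and "C3 = gegenbauer \<nu> (Suc (Suc (Suc n))) x"
    and "C4 = gegenbauer \<nu> (Suc (Suc (Suc (Suc n)))) x"
  have r1: "(m + 2) * B2 = 2 * (m + 2 + \<nu>) * x * B1 - (m + 2 + 2 * \<nu>) * B0"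
    using gegenbauer_rec[of n "\<nu> + 1" x] by (simp add: m_def B0_def B1_def B2_def algebra_simps)
  have r2: "(m + 4) * B4 = 2 * (m + 4 + \<nu>) * x * B3 - (m + 4 + 2 * \<nu>) * B2"
    using gegenbauer_rec[of "Suc (Suc n)" "\<nu> + 1" x]
    by (simp add: m_def B2_def B3_def B4_def algebra_simps)
  have r3: "(m + 4) * C4 = 2 * (m + 3 + \<nu>) * x * C3 - (m + 2 + 2 * \<nu>) * C2"
    using gegenbauer_rec[of "Suc (Suc n)" "\<nu>" x]
    by (simp add: m_def C2_def C3_def C4_def algebra_simps)
  have i1: "(m + 2 + \<nu>) * C2 = \<nu> * (B2 - B0)"
    using ge2(1) by (simp add: m_def C2_def B2_def B0_def)
  have i2: "(m + 3 + \<nu>) * C3 = \<nu> * (B3 - B1)"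
    using ge2(2) by (simp add: m_def C3_def B3_def B1_def algebra_simps)
  have "(m + 4) * (m + 2 + \<nu>) * ((m + 4 + \<nu>) * C4) = (m + 4) * (m + 2 + \<nu>) * (\<nu> * (B4 - B2))"
    using r1 r2 r3 i1 i2 by algebra
  moreover have "(m + 4) * (m + 2 + \<nu>) \<noteq> 0" using m assms by auto
  ultimately have "(m + 4 + \<nu>) * C4 = \<nu> * (B4 - B2)"
    using mult_left_cancel by blast
  then show ?case by (simp add: m_def B4_def B2_def C4_def algebra_simps)
qed

text \<open>
  Differentiating the recurrence leaves one undifferentiated term, which the index shift
  rewrites in terms of index \<open>\<nu> + 1\<close>; what remains is the recurrence of that index.
\<close>

lemma poly_pderiv_gegenbauer:
  assumes "\<nu> > 0"
  shows "poly (pderiv (gegenbauer_poly \<nu> (Suc n))) x = 2 * \<nu> * gegenbauer (\<nu> + 1) n x"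
proof (induction n rule: induct_nat_012)
  case 0
  show ?case by (simp add: gegenbauer_def pderiv_pCons)
next
  case 1
  show ?case by (simp add: gegenbauer_def pderiv_pCons pderiv_smult pderiv_diff pderiv_mult algebra_simps)
next
  case (ge2 n)
  define m where "m = real n"
  have m: "m \<ge> 0" by (simp add: m_def)
  define B0 B1 B2 where "B0 = gegenbauer (\<nu> + 1) n x" and "B1 = gegenbauer (\<nu> + 1) (Suc n) x"
    and "B2 = gegenbauer (\<nu> + 1) (Suc (Suc n)) x"
  define C2 D3 where "C2 = gegenbauer \<nu> (Suc (Suc n)) x"
    and "D3 = poly (pderiv (gegenbauer_poly \<nu> (Suc (Suc (Suc n))))) x"
  have d1: "poly (pderiv (gegenbauer_poly \<nu> (Suc n))) x = 2 * \<nu> * B0"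
    using ge2(1) by (simp add: B0_def)
  have d2: "poly (pderiv (gegenbauer_poly \<nu> (Suc (Suc n)))) x = 2 * \<nu> * B1"
    using ge2(2) by (simp add: B1_def)
  have "(m + 3) * D3 = 2 * (m + 2 + \<nu>) * (C2 + x * poly (pderiv (gegenbauer_poly \<nu> (Suc (Suc n)))) x)
        - (m + 1 + 2 * \<nu>) * poly (pderiv (gegenbauer_poly \<nu> (Suc n))) x"
    unfolding D3_def C2_def gegenbauer_def gegenbauer_poly.simps(3)[of \<nu> "Suc n"]
    by (simp add: pderiv_smult pderiv_diff pderiv_mult pderiv_pCons m_def add_ac
             del: gegenbauer_poly.simps) (simp add: algebra_simps del: gegenbauer_poly.simps)
  then have r3: "(m + 3) * D3 = 2 * (m + 2 + \<nu>) * (C2 + x * (2 * \<nu> * B1)) - (m + 1 + 2 * \<nu>) * (2 * \<nu> * B0)"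
    unfolding d1 d2 .
  have r1: "(m + 2) * B2 = 2 * (m + 2 + \<nu>) * x * B1 - (m + 2 + 2 * \<nu>) * B0"
    using gegenbauer_rec[of n "\<nu> + 1" x] by (simp add: m_def B0_def B1_def B2_def algebra_simps)
  have i1: "(m + 2 + \<nu>) * C2 = \<nu> * (B2 - B0)"
    using gegenbauer_index_shift[OF assms, of n x] by (simp add: m_def C2_def B2_def B0_def)
  have "(m + 3) * D3 = (m + 3) * (2 * \<nu> * B2)"
    using r1 r3 i1 by algebra
  then have "D3 = 2 * \<nu> * B2" using m by simp
  then show ?case by (simp add: D3_def B2_def)
qed

text \<open>
  In view of the derivative formula, the left-hand side is
  \<open>(1 - x\<^sup>2)\<close> times the derivative of \<open>C\<^sub>n\<^sub>+\<^sub>1\<close>. It is what allows the product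
  formula to close: the terms of index \<open>\<nu> + 1\<close> that arise there carry exactly this factor.
\<close>

lemma gegenbauer_structure:
  assumes "\<nu> > 0"
  shows "2 * \<nu> * (1 - x\<^sup>2) * gegenbauer (\<nu> + 1) n x =
     (real n + 2 * \<nu>) * gegenbauer \<nu> n x - (real n + 1) * x * gegenbauer \<nu> (Suc n) x"
proof (induction n rule: induct_nat_012)
  case 0
  show ?case by (simp add: gegenbauer_def power2_eq_square algebra_simps)
next
  case 1
  show ?case by (simp add: gegenbauer_def power2_eq_square algebra_simps)
next
  case (ge2 n)
  define m where "m = real n"
  have m: "m \<ge> 0" by (simp add: m_def)
  define B0 B1 B2 where "B0 = gegenbauer (\<nu> + 1) n x" and "B1 = gegenbauer (\<nu> + 1) (Suc n) x"
    and "B2 = gegenbauer (\<nu> + 1) (Suc (Suc n)) x"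
  define C0 C1 C2 C3 where "C0 = gegenbauer \<nu> n x" and "C1 = gegenbauer \<nu> (Suc n) x"
    and "C2 = gegenbauer \<nu> (Suc (Suc n)) x" and "C3 = gegenbauer \<nu> (Suc (Suc (Suc n))) x"
  have r1: "(m + 2) * B2 = 2 * (m + 2 + \<nu>) * x * B1 - (m + 2 + 2 * \<nu>) * B0"
    using gegenbauer_rec[of n "\<nu> + 1" x] by (simp add: m_def B0_def B1_def B2_def algebra_simps)
  have r2: "(m + 2) * C2 = 2 * (m + 1 + \<nu>) * x * C1 - (m + 2 * \<nu>) * C0"
    using gegenbauer_rec[of n "\<nu>" x] by (simp add: m_def C0_def C1_def C2_def algebra_simps)
  have r3: "(m + 3) * C3 = 2 * (m + 2 + \<nu>) * x * C2 - (m + 1 + 2 * \<nu>) * C1"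
    using gegenbauer_rec[of "Suc n" "\<nu>" x] by (simp add: m_def C1_def C2_def C3_def algebra_simps)
  have i1: "2 * \<nu> * (1 - x\<^sup>2) * B0 = (m + 2 * \<nu>) * C0 - (m + 1) * x * C1"
    using ge2(1) by (simp add: m_def C0_def B0_def C1_def algebra_simps)
  have i2: "2 * \<nu> * (1 - x\<^sup>2) * B1 = (m + 1 + 2 * \<nu>) * C1 - (m + 2) * x * C2"
    using ge2(2) by (simp add: m_def C2_def B1_def C1_def algebra_simps)
  have "(m + 2) * (2 * \<nu> * (1 - x\<^sup>2) * B2) = (m + 2) * ((m + 2 + 2 * \<nu>) * C2 - (m + 3) * x * C3)"
    using r1 r2 r3 i1 i2 by algebra
  then have "2 * \<nu> * (1 - x\<^sup>2) * B2 = (m + 2 + 2 * \<nu>) * C2 - (m + 3) * x * C3"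
    using m by simp
  then show ?case by (simp add: m_def B2_def C2_def C3_def algebra_simps)
qed

section \<open>The two Beta laws\<close>

text \<open>
  Substitute \<open>t = u\<^sup>2\<close> in the Beta integral.
\<close>

lemma has_bochner_integral_beta_square:
  fixes a b :: real
  assumes "a > 0" "b > 0"
  shows "has_bochner_integral lborel
    (\<lambda>u. indicator {0..1} u * (u powr (2 * a - 1) * (1 - u\<^sup>2) powr (b - 1))) (Beta a b / 2)"
proof (rule has_bochner_integral_nn_integral)
  let ?f = "\<lambda>u. indicator {0..1} u * (u powr (2 * a - 1) * (1 - u\<^sup>2) powr (b - 1)) :: real"
  have B: "Beta a b \<ge> 0" using assms by (simp add: Beta_def Gamma_real_pos less_imp_le)
  then show "0 \<le> Beta a b / 2" by simp
  have "ennreal (Beta a b) =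
      (\<integral>\<^sup>+t. ennreal (t powr (a - 1) * (1 - t) powr (b - 1) * indicator {0\<^sup>2..1\<^sup>2} t) \<partial>lborel)"
    using nn_integral_has_integral_lebesgue[OF _ has_integral_Beta_real[OF assms]]
    by (simp add: mult_ac ennreal_mult' ennreal_indicator)
  also have "\<dots> = (\<integral>\<^sup>+u. ennreal ((u\<^sup>2) powr (a - 1) * (1 - u\<^sup>2) powr (b - 1) * (2 * u) *
      indicator {0..1} u) \<partial>lborel)"
    by (subst nn_integral_substitution[where g = "\<lambda>u. u\<^sup>2" and g' = "\<lambda>u. 2 * u"])
       (auto intro!: derivative_eq_intros continuous_intros simp: set_borel_measurable_def)
  also have "\<dots> = (\<integral>\<^sup>+u. 2 * ennreal (?f u) \<partial>lborel)"
  proof (intro nn_integral_cong_AE AE_I2 impI)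
    fix u :: real
    have "(u\<^sup>2) powr (a - 1) * u = u powr (2 * a - 1)" if "u > 0"
    proof -
      have "(u\<^sup>2) powr (a - 1) * u = u powr (2 * (a - 1)) * u powr 1"
        using that powr_powr[of u 2 "a - 1"] by simp
      also have "\<dots> = u powr (2 * a - 1)" by (subst powr_add[symmetric]) simp
      finally show ?thesis .
    qed
    then have "(u\<^sup>2) powr (a - 1) * (1 - u\<^sup>2) powr (b - 1) * (2 * u) * indicator {0..1} u = 2 * ?f u"
      by (cases "u > 0") (auto simp: indicator_def mult_ac)
    then show "ennreal ((u\<^sup>2) powr (a - 1) * (1 - u\<^sup>2) powr (b - 1) * (2 * u) * indicator {0..1} u)
        = 2 * ennreal (?f u)"
      using ennreal_mult'[of 2 "?f u"] by (simp only:) simp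
  qed
  also have "\<dots> = 2 * (\<integral>\<^sup>+u. ennreal (?f u) \<partial>lborel)"
    by (rule nn_integral_cmult) measurable
  finally have "2 * (\<integral>\<^sup>+u. ennreal (?f u) \<partial>lborel) = 2 * ennreal (Beta a b / 2)"
    using ennreal_mult'[of 2 "Beta a b / 2"] B by simp
  then show "(\<integral>\<^sup>+u. ennreal (?f u) \<partial>lborel) = ennreal (Beta a b / 2)"
    by (simp add: ennreal_mult_cancel_left)
qed auto

lemma has_bochner_integral_AE_eq:
  assumes "has_bochner_integral M f c" "AE x in M. f x = g x" "g \<in> borel_measurable M"
  shows "has_bochner_integral M g c"
  using assms has_bochner_integral_cong_AE[of f M g c] by (auto simp: has_bochner_integral_iff)

lemma has_bochner_integral_symmetric_beta:
  fixes b :: real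
  assumes "b > 0"
  shows "has_bochner_integral lborel
    (\<lambda>v. indicator {-1..1} v * (1 - v\<^sup>2) powr (b - 1)) (Beta (1/2) b)"
proof -
  let ?f = "\<lambda>v. indicator {0..1} v * (1 - v\<^sup>2) powr (b - 1) :: real"
  have "has_bochner_integral lborel (\<lambda>u. indicator {0..1} u * (u powr (2 * (1/2) - 1) * (1 - u\<^sup>2) powr (b - 1))) (Beta (1/2) b / 2)"
    by (rule has_bochner_integral_beta_square) (use assms in auto)
  then have 1: "has_bochner_integral lborel ?f (Beta (1/2) b / 2)"
    by (rule has_bochner_integral_AE_eq)
       (auto simp: indicator_def intro: AE_mp[OF AE_lborel_singleton[of 0]])
  have "has_bochner_integral lborel (\<lambda>v. ?f (0 + (-1) * v)) ((Beta (1/2) b / 2) /\<^sub>R \<bar>-1\<bar>)"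
    using 1 by (subst lborel_has_bochner_integral_real_affine_iff[of "-1", symmetric]) auto
  then have 2: "has_bochner_integral lborel (\<lambda>v. ?f (- v)) (Beta (1/2) b / 2)" by simp
  have "has_bochner_integral lborel (\<lambda>v. ?f v + ?f (- v)) (Beta (1/2) b / 2 + Beta (1/2) b / 2)"
    by (rule has_bochner_integral_add[OF 1 2])
  then have "has_bochner_integral lborel (\<lambda>v. ?f v + ?f (- v)) (Beta (1/2) b)" by simp
  then show ?thesis
    by (rule has_bochner_integral_AE_eq)
       (auto simp: indicator_def intro: AE_mp[OF AE_lborel_singleton[of 0]])
qed

lemma gegenbauer_measure_eq:
  "gegenbauer_measure (\<nu> - 1/2) =
     density lborel (\<lambda>v. ennreal (indicator {-1..1} v * (1 - v\<^sup>2) powr (\<nu> - 1) / Beta (1/2) \<nu>))"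
proof -
  have "\<nu> - 1/2 + 1 = \<nu> + 1/2" "\<nu> - 1/2 + 1/2 = \<nu>" "\<nu> - 1/2 - 1/2 = \<nu> - 1" by simp_all
  then show ?thesis
    unfolding gegenbauer_measure_def by (simp add: Beta_def Gamma_one_half_real mult_ac add_ac)
qed

lemma sonine_measure_eq:
  "sonine_measure \<nu> lam = density lborel (\<lambda>u. ennreal (indicator {0..1} u *
     (2 / Beta (\<nu> + 1/2) (lam - \<nu>) * u powr (2 * \<nu>) * (1 - u\<^sup>2) powr (lam - \<nu> - 1))))"
  by (simp add: sonine_measure_def Beta_def add_ac)

lemma sets_gegenbauer_measure [simp, measurable_cong]: "sets (gegenbauer_measure \<kappa>) = sets borel"
  and sets_sonine_measure [simp, measurable_cong]: "sets (sonine_measure \<nu> lam) = sets borel"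
  by (simp_all add: gegenbauer_measure_def sonine_measure_def)

lemma Beta_pos_real: "a > 0 \<Longrightarrow> b > 0 \<Longrightarrow> Beta a b > (0::real)"
  by (simp add: Beta_def Gamma_real_pos)

lemma has_bochner_integral_gegenbauer_measure_iff:
  assumes "\<nu> > 0" and [measurable]: "f \<in> borel_measurable borel"
  shows "has_bochner_integral (gegenbauer_measure (\<nu> - 1/2)) f c \<longleftrightarrow>
    has_bochner_integral lborel
      (\<lambda>v. indicator {-1..1} v * (1 - v\<^sup>2) powr (\<nu> - 1) / Beta (1/2) \<nu> * f v :: real) c"
  unfolding gegenbauer_measure_eq has_bochner_integral_iff
  using Beta_pos_real[of "1/2" \<nu>] assms(1)
  by (subst integrable_density integral_density; simp)+

lemma has_bochner_integral_sonine_measure_iff: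
  assumes "\<nu> > 0" "\<nu> < lam" and [measurable]: "f \<in> borel_measurable borel"
  shows "has_bochner_integral (sonine_measure \<nu> lam) f c \<longleftrightarrow>
    has_bochner_integral lborel (\<lambda>u. indicator {0..1} u *
     (2 / Beta (\<nu> + 1/2) (lam - \<nu>) * u powr (2 * \<nu>) * (1 - u\<^sup>2) powr (lam - \<nu> - 1)) * f u :: real) c"
  unfolding sonine_measure_eq has_bochner_integral_iff
  using Beta_pos_real[of "\<nu> + 1/2" "lam - \<nu>"] assms(1,2)
  by (subst integrable_density integral_density; simp)+

text \<open>
  Multiplication by a power of \<open>1 - v\<^sup>2\<close> only moves the Beta parameter. Total mass 1 is the case
  \<open>c = 0\<close>; a negative \<open>c\<close> shows that the \<open>v\<close>-part of the majorant at \<open>r = 1\<close> is integrable.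
\<close>

lemma has_bochner_integral_gegenbauer_measure_powr:
  assumes "\<nu> > 0" "\<nu> + c > 0"
  shows "has_bochner_integral (gegenbauer_measure (\<nu> - 1/2)) (\<lambda>v. (1 - v\<^sup>2) powr c)
           (Beta (1/2) (\<nu> + c) / Beta (1/2) \<nu>)"
proof -
  have "has_bochner_integral lborel (\<lambda>v. inverse (Beta (1/2) \<nu>) *
      (indicator {-1..1} v * (1 - v\<^sup>2) powr (\<nu> + c - 1))) (inverse (Beta (1/2) \<nu>) * Beta (1/2) (\<nu> + c))"
    by (intro has_bochner_integral_mult_right has_bochner_integral_symmetric_beta assms)
  also have "(\<lambda>v. inverse (Beta (1/2) \<nu>) * (indicator {-1..1} v * (1 - v\<^sup>2) powr (\<nu> + c - 1))) =
      (\<lambda>v. indicator {-1..1} v * (1 - v\<^sup>2) powr (\<nu> - 1) / Beta (1/2) \<nu> * (1 - v\<^sup>2) powr c)"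
    by (simp add: fun_eq_iff field_simps flip: powr_add)
  finally show ?thesis
    by (subst has_bochner_integral_gegenbauer_measure_iff) (use assms in \<open>simp_all add: field_simps\<close>)
qed

lemma prob_space_if_integral_1:
  assumes "has_bochner_integral M (\<lambda>_. 1 :: real) 1"
  shows "prob_space M"
proof (rule prob_spaceI)
  have "(\<integral>\<^sup>+x. ennreal 1 \<partial>M) = ennreal 1"
    using assms by (subst nn_integral_eq_integral) (auto simp: has_bochner_integral_iff)
  then show "emeasure M (space M) = 1" by simp
qed

lemma prob_space_gegenbauer_measure:
  assumes "\<nu> > 0"
  shows "prob_space (gegenbauer_measure (\<nu> - 1/2))"
proof (rule prob_space_if_integral_1)
  have "has_bochner_integral (gegenbauer_measure (\<nu> - 1/2)) (\<lambda>v. (1 - v\<^sup>2) powr 0) 1"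
    using has_bochner_integral_gegenbauer_measure_powr[of \<nu> 0] Beta_pos_real[of "1/2" \<nu>] assms by simp
  moreover have "AE v in gegenbauer_measure (\<nu> - 1/2). (1 - v\<^sup>2) powr 0 = 1"
  proof -
    have "AE v in lborel. v \<noteq> (-1::real)" "AE v in lborel. v \<noteq> (1::real)"
      by (rule AE_lborel_singleton)+
    then have "AE v in lborel. (1 - v\<^sup>2) powr 0 = (1::real)"
      by eventually_elim (auto simp: power2_eq_1_iff)
    then show ?thesis
      unfolding gegenbauer_measure_eq by (subst AE_density) auto
  qed
  ultimately show "has_bochner_integral (gegenbauer_measure (\<nu> - 1/2)) (\<lambda>_. 1 :: real) 1"
    by (rule has_bochner_integral_AE_eq) simp
qed

lemma AE_gegenbauer_measure: "AE v in gegenbauer_measure \<kappa>. v \<in> {-1<..<1}"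
proof -
  have "AE v in lborel. v \<noteq> (-1::real)" "AE v in lborel. v \<noteq> (1::real)"
    by (rule AE_lborel_singleton)+
  then show ?thesis
    unfolding gegenbauer_measure_def
    by (subst AE_density) (auto elim!: eventually_elim2 simp: indicator_def)
qed

lemma AE_sonine_measure: "AE u in sonine_measure \<nu> lam. u \<in> {0<..<1}"
proof -
  have "AE u in lborel. u \<noteq> (0::real)" "AE u in lborel. u \<noteq> (1::real)"
    by (rule AE_lborel_singleton)+
  then show ?thesis
    unfolding sonine_measure_def
    by (subst AE_density) (auto elim!: eventually_elim2 simp: indicator_def)
qed

text \<open>
  The exponents are again absorbed into the Beta parameters. The case \<open>a = k\<close>, \<open>b = 0\<close> gives the
  moments; negative exponents occur in the majorant at \<open>r = 1\<close>.
\<close>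

lemma has_bochner_integral_sonine_measure_powr:
  assumes "\<nu> > 0" "\<nu> < lam" "\<nu> + 1/2 + a > 0" "lam - \<nu> + b > 0"
  shows "has_bochner_integral (sonine_measure \<nu> lam) (\<lambda>u. u powr (2 * a) * (1 - u\<^sup>2) powr b)
           (Beta (\<nu> + 1/2 + a) (lam - \<nu> + b) / Beta (\<nu> + 1/2) (lam - \<nu>))"
proof -
  let ?K = "2 / Beta (\<nu> + 1/2) (lam - \<nu>)"
  have "has_bochner_integral lborel (\<lambda>u. ?K * (indicator {0..1} u *
      (u powr (2 * (\<nu> + 1/2 + a) - 1) * (1 - u\<^sup>2) powr (lam - \<nu> + b - 1))))
      (?K * (Beta (\<nu> + 1/2 + a) (lam - \<nu> + b) / 2))"
    by (intro has_bochner_integral_mult_right has_bochner_integral_beta_square assms)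
  also have "(\<lambda>u. ?K * (indicator {0..1} u *
      (u powr (2 * (\<nu> + 1/2 + a) - 1) * (1 - u\<^sup>2) powr (lam - \<nu> + b - 1)))) =
     (\<lambda>u. indicator {0..1} u * (?K * u powr (2 * \<nu>) * (1 - u\<^sup>2) powr (lam - \<nu> - 1)) *
        (u powr (2 * a) * (1 - u\<^sup>2) powr b))" (is "?L = ?R")
  proof
    fix u :: real
    have "u powr (2 * (\<nu> + 1/2 + a) - 1) = u powr (2 * \<nu>) * u powr (2 * a)"
      by (subst powr_add[symmetric]) (simp add: algebra_simps)
    moreover have "(1 - u\<^sup>2) powr (lam - \<nu> + b - 1) = (1 - u\<^sup>2) powr (lam - \<nu> - 1) * (1 - u\<^sup>2) powr b"
      by (subst powr_add[symmetric]) (simp add: algebra_simps)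
    ultimately show "?L u = ?R u" by (simp add: mult_ac)
  qed
  finally show ?thesis
    by (subst has_bochner_integral_sonine_measure_iff) (use assms in simp_all)
qed

lemma has_bochner_integral_sonine_measure_moment:
  assumes "\<nu> > 0" "\<nu> < lam"
  shows "has_bochner_integral (sonine_measure \<nu> lam) (\<lambda>u. u ^ (2 * k))
           (pochhammer (\<nu> + 1/2) k / pochhammer (lam + 1/2) k)"
proof -
  have mom: "has_bochner_integral (sonine_measure \<nu> lam) (\<lambda>u. u powr (2 * real k) * (1 - u\<^sup>2) powr 0)
      (Beta (\<nu> + 1/2 + real k) (lam - \<nu> + 0) / Beta (\<nu> + 1/2) (lam - \<nu>))"
    by (rule has_bochner_integral_sonine_measure_powr) (use assms in auto)
  have ae: "AE u in sonine_measure \<nu> lam. u powr (2 * real k) * (1 - u\<^sup>2) powr 0 = u ^ (2 * k)"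
    using AE_sonine_measure
  proof eventually_elim
    case (elim u)
    then have "u\<^sup>2 < 1\<^sup>2" by (intro power_strict_mono) auto
    moreover have "u powr (2 * real k) = u ^ (2 * k)" using elim powr_realpow[of u "2 * k"] by simp
    ultimately show ?case by simp
  qed
  have beta: "Beta (\<nu> + 1/2 + real k) (lam - \<nu> + 0) / Beta (\<nu> + 1/2) (lam - \<nu>) =
      pochhammer (\<nu> + 1/2) k / pochhammer (lam + 1/2) k"
  proof -
    have p: "pochhammer z k = Gamma (z + real k) / Gamma z" if "z > 0" for z :: real
      using that nonpos_Ints_nonpos[of z] by (intro pochhammer_Gamma) linarith
    have B1: "Beta (\<nu> + 1/2 + real k) (lam - \<nu> + 0) =
        Gamma (\<nu> + 1/2 + real k) * Gamma (lam - \<nu>) / Gamma (lam + 1/2 + real k)"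
      unfolding Beta_def by (rule arg_cong2[where f = "(/)"]) (simp_all add: add_ac)
    have B2: "Beta (\<nu> + 1/2) (lam - \<nu>) = Gamma (\<nu> + 1/2) * Gamma (lam - \<nu>) / Gamma (lam + 1/2)"
      unfolding Beta_def by (rule arg_cong2[where f = "(/)"]) (simp_all add: add_ac)
    have alg: "(X * g / Y) / (Z * g / T) = (X / Z) / (Y / T)" if "g > 0" for X g Y Z T :: real
      using that by simp
    have g: "Gamma (lam - \<nu>) > 0"
      by (rule Gamma_real_pos) (use assms in simp)
    have "\<nu> + 1/2 > 0" "lam + 1/2 > 0" using assms by auto
    then show ?thesis unfolding B1 B2 by (simp only: p alg[OF g])
  qed
  show ?thesis
    using mom unfolding beta by (rule has_bochner_integral_AE_eq[OF _ ae]) simp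
qed

lemma prob_space_sonine_measure:
  assumes "\<nu> > 0" "\<nu> < lam"
  shows "prob_space (sonine_measure \<nu> lam)"
  using has_bochner_integral_sonine_measure_moment[OF assms, of 0]
  by (intro prob_space_if_integral_1) simp

lemma gegenbauer_measure_integrable_continuous:
  assumes "\<nu> > 0" "continuous_on UNIV f"
  shows "integrable (gegenbauer_measure (\<nu> - 1/2)) (f :: real \<Rightarrow> real)"
proof -
  interpret prob_space "gegenbauer_measure (\<nu> - 1/2)"
    by (rule prob_space_gegenbauer_measure) fact
  have "compact (f ` {-1..1})"
    by (intro compact_continuous_image continuous_on_subset[OF assms(2)]) auto
  then obtain B where B: "\<And>v. v \<in> {-1..1} \<Longrightarrow> norm (f v) \<le> B"
    by (metis (no_types) bounded_iff compact_imp_bounded image_eqI)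
  show ?thesis
  proof (rule integrable_const_bound)
    show "AE v in gegenbauer_measure (\<nu> - 1/2). norm (f v) \<le> B"
      using AE_gegenbauer_measure by eventually_elim (use B in auto)
    show "f \<in> borel_measurable (gegenbauer_measure (\<nu> - 1/2))"
      using borel_measurable_continuous_onI[OF assms(2)] by simp
  qed
qed

lemma has_bochner_integral_imp_has_integral:
  fixes f :: "real \<Rightarrow> real"
  assumes "has_bochner_integral lborel f c"
  shows "(f has_integral c) UNIV"
  using has_integral_integral_lborel[of f] assms by (simp add: has_bochner_integral_iff)

text \<open>
  This is the statement that the derivative of \<open>q(v) (1 - v\<^sup>2) powr \<nu>\<close> integrates to zero, since the
  function vanishes at both end points. The normalising constants of the indices \<open>\<nu>\<close> and
  \<open>\<nu> + 1\<close> differ by the factor \<open>2\<nu> / (2\<nu> + 1)\<close>, which leaves \<open>1 / (2\<nu> + 1)\<close>.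
\<close>

lemma gegenbauer_measure_by_parts:
  assumes nu: "\<nu> > 0"
    and q: "\<And>v. (q has_real_derivative q' v) (at v)" and q': "continuous_on UNIV q'"
  shows "(\<integral>v. v * q v \<partial>gegenbauer_measure (\<nu> - 1/2)) =
           (\<integral>v. q' v \<partial>gegenbauer_measure (\<nu> + 1 - 1/2)) / (2 * \<nu> + 1)"
proof -
  define B where "B = Beta (1/2) \<nu>"
  define B' where "B' = Beta (1/2) (\<nu> + 1)"
  have pos: "B > 0" "B' > 0" unfolding B_def B'_def using nu by (auto intro!: Beta_pos_real)
  have "\<nu> \<notin> \<int>\<^sub>\<le>\<^sub>0" using nu nonpos_Ints_nonpos[of \<nu>] by linarith
  then have "(1/2 + \<nu>) * B' = \<nu> * B"
    unfolding B_def B'_def by (rule Beta_plus1_right)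
  then have BB: "B' * (2 * \<nu> + 1) = 2 * \<nu> * B" by (simp add: algebra_simps)
  have qc: "continuous_on UNIV q" using q DERIV_continuous_on by blast
  note [measurable] = borel_measurable_continuous_onI[OF q'] borel_measurable_continuous_onI[OF qc]
  define J where "J = (\<integral>v. v * q v \<partial>gegenbauer_measure (\<nu> - 1/2))"
  define J' where "J' = (\<integral>v. q' v \<partial>gegenbauer_measure (\<nu> + 1 - 1/2))"
  have "has_bochner_integral (gegenbauer_measure (\<nu> - 1/2)) (\<lambda>v. v * q v) J"
    unfolding J_def by (intro has_bochner_integral_integrable gegenbauer_measure_integrable_continuous
       continuous_intros qc nu)
  then have 1: "has_bochner_integral lborel
      (\<lambda>v. indicator {-1..1} v * (1 - v\<^sup>2) powr (\<nu> - 1) / B * (v * q v)) J"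
    by (subst (asm) has_bochner_integral_gegenbauer_measure_iff) (auto simp: B_def nu)
  have "has_bochner_integral (gegenbauer_measure (\<nu> + 1 - 1/2)) q' J'"
    unfolding J'_def by (intro has_bochner_integral_integrable gegenbauer_measure_integrable_continuous q')
      (use nu in auto)
  then have 2: "has_bochner_integral lborel
      (\<lambda>v. indicator {-1..1} v * (1 - v\<^sup>2) powr (\<nu> + 1 - 1) / B' * q' v) J'"
    by (subst (asm) has_bochner_integral_gegenbauer_measure_iff) (use nu in \<open>auto simp: B'_def\<close>)
  let ?h = "\<lambda>v. q' v * (1 - v\<^sup>2) powr \<nu> + q v * (\<nu> * (1 - v\<^sup>2) powr (\<nu> - 1) * (- 2 * v))"
  have "has_bochner_integral lborel (\<lambda>v. B' * (indicator {-1..1} v * (1 - v\<^sup>2) powr (\<nu> + 1 - 1) / B' * q' v)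
      - (2 * \<nu> * B) * (indicator {-1..1} v * (1 - v\<^sup>2) powr (\<nu> - 1) / B * (v * q v)))
      (B' * J' - (2 * \<nu> * B) * J)"
    by (intro has_bochner_integral_diff has_bochner_integral_mult_right 1 2)
  also have "(\<lambda>v. B' * (indicator {-1..1} v * (1 - v\<^sup>2) powr (\<nu> + 1 - 1) / B' * q' v)
      - (2 * \<nu> * B) * (indicator {-1..1} v * (1 - v\<^sup>2) powr (\<nu> - 1) / B * (v * q v))) =
      (\<lambda>v. if v \<in> {-1..1} then ?h v else 0)"
    using pos by (auto simp: fun_eq_iff indicator_def field_simps)
  finally have "((\<lambda>v. if v \<in> {-1..1} then ?h v else 0) has_integral (B' * J' - (2 * \<nu> * B) * J)) UNIV"
    by (rule has_bochner_integral_imp_has_integral)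
  then have i1: "(?h has_integral (B' * J' - (2 * \<nu> * B) * J)) {-1..1}"
    by (subst (asm) has_integral_restrict_UNIV)
  have "(?h has_integral (q 1 * (1 - 1\<^sup>2) powr \<nu> - q (-1) * (1 - (-1)\<^sup>2) powr \<nu>)) {-1..1}"
  proof (rule fundamental_theorem_of_calculus_interior)
    show "continuous_on {-1..1} (\<lambda>v. q v * (1 - v\<^sup>2) powr \<nu>)"
      by (intro continuous_intros continuous_on_powr' continuous_on_subset[OF qc])
         (use nu in \<open>auto simp: abs_square_le_1 abs_le_iff\<close>)
    fix v :: real assume v: "v \<in> {-1<..<1}"
    then have "v\<^sup>2 < 1" by (simp add: abs_square_less_1 abs_less_iff)
    then show "((\<lambda>v. q v * (1 - v\<^sup>2) powr \<nu>) has_vector_derivative ?h v) (at v)"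
      unfolding has_real_derivative_iff_has_vector_derivative[symmetric]
      by (auto intro!: derivative_eq_intros q simp: field_simps)
  qed auto
  then have "(?h has_integral 0) {-1..1}" by simp
  with i1 have "B' * J' - (2 * \<nu> * B) * J = 0" by (rule has_integral_unique)
  then have "B' * J' = B' * ((2 * \<nu> + 1) * J)" using BB by (simp add: mult_ac)
  then have "J' = (2 * \<nu> + 1) * J" using pos by simp
  then have "J = J' / (2 * \<nu> + 1)" using nu by simp
  then show ?thesis by (simp only: J_def J'_def)
qed

section \<open>The product formula\<close>

lemma ultraspherical_0 [simp]: "ultraspherical \<nu> 0 x = 1"
  and ultraspherical_Suc_0: "\<nu> > 0 \<Longrightarrow> ultraspherical \<nu> (Suc 0) x = x"
  by (simp_all add: ultraspherical_def)

lemma gegenbauer_eq_ultraspherical: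
  assumes "\<nu> > 0"
  shows "gegenbauer \<nu> n x = pochhammer (2 * \<nu>) n / fact n * ultraspherical \<nu> n x"
  using pochhammer_pos[of "2 * \<nu>" n] assms
  by (simp add: ultraspherical_def poly_gegenbauer_1 gegenbauer_def)

lemma continuous_on_ultraspherical [continuous_intros]:
  "continuous_on A f \<Longrightarrow> continuous_on A (\<lambda>x. ultraspherical \<nu> n (f x))"
  unfolding ultraspherical_def divide_inverse by (intro continuous_intros)

lemma borel_measurable_ultraspherical [measurable]:
  "f \<in> borel_measurable M \<Longrightarrow> (\<lambda>x. ultraspherical \<nu> n (f x)) \<in> borel_measurable M"
  using measurable_compose[of f M borel "ultraspherical \<nu> n" borel]
    borel_measurable_continuous_onI[OF continuous_on_ultraspherical[OF continuous_on_id]]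
  by auto

lemma ultraspherical_rec:
  assumes "\<nu> > 0"
  shows "(real n + 1 + 2 * \<nu>) * ultraspherical \<nu> (Suc (Suc n)) x =
     2 * (real n + 1 + \<nu>) * x * ultraspherical \<nu> (Suc n) x - (real n + 1) * ultraspherical \<nu> n x"
proof -
  define m where "m = real n"
  define c where "c = pochhammer (2 * \<nu>) n / fact n"
  have m: "m \<ge> 0" and c: "c > 0" using assms by (auto simp: m_def c_def pochhammer_pos)
  define W0 W1 W2 where "W0 = ultraspherical \<nu> n x" and "W1 = ultraspherical \<nu> (Suc n) x"
    and "W2 = ultraspherical \<nu> (Suc (Suc n)) x"
  define C0 C1 C2 where "C0 = gegenbauer \<nu> n x" and "C1 = gegenbauer \<nu> (Suc n) x"
    and "C2 = gegenbauer \<nu> (Suc (Suc n)) x"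
  have C: "C0 = c * W0" "(m + 1) * C1 = c * (2 * \<nu> + m) * W1"
      "(m + 2) * (m + 1) * C2 = c * (2 * \<nu> + m) * (2 * \<nu> + m + 1) * W2"
    using m unfolding C0_def C1_def C2_def gegenbauer_eq_ultraspherical[OF assms] c_def m_def W0_def W1_def W2_def
    by (simp_all add: pochhammer_Suc divide_simps) (simp_all add: algebra_simps)
  have "(m + 2) * C2 = 2 * (m + 1 + \<nu>) * x * C1 - (m + 2 * \<nu>) * C0"
    using gegenbauer_rec[of n \<nu> x] by (simp add: m_def C0_def C1_def C2_def)
  with C have "c * (2 * \<nu> + m) * ((m + 1 + 2 * \<nu>) * W2) =
      c * (2 * \<nu> + m) * (2 * (m + 1 + \<nu>) * x * W1 - (m + 1) * W0)"
    by algebra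
  moreover have "c * (2 * \<nu> + m) \<noteq> 0" using c m assms by simp
  ultimately show ?thesis unfolding W0_def W1_def W2_def m_def using mult_left_cancel by blast
qed

lemma pochhammer_index_shift:
  "2 * \<nu> * (2 * \<nu> + 1) * (pochhammer (2 * (\<nu> + 1)) n / fact n) =
     (real n + 1) * (real n + 1 + 2 * \<nu>) * (pochhammer (2 * \<nu>) (Suc n) / fact (Suc n) :: real)"
proof -
  have "pochhammer (2 * \<nu>) (Suc (Suc n)) = 2 * \<nu> * ((2 * \<nu> + 1) * pochhammer (2 * (\<nu> + 1)) n)"
    by (simp only: pochhammer_rec[of "2 * \<nu>" "Suc n"] pochhammer_rec[of "2 * \<nu> + 1" n])
       (simp add: distrib_left add.assoc)
  then have "2 * \<nu> * (2 * \<nu> + 1) * pochhammer (2 * (\<nu> + 1)) n =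
      pochhammer (2 * \<nu>) (Suc n) * (2 * \<nu> + real n + 1)"
    unfolding pochhammer_Suc[of _ "Suc n"] by (simp add: mult_ac add_ac)
  then show ?thesis by (simp add: divide_simps del: pochhammer_Suc) (simp add: algebra_simps)
qed

lemma ultraspherical_structure:
  assumes "\<nu> > 0"
  shows "(1 - x\<^sup>2) * (real n + 1 + 2 * \<nu>) * ultraspherical (\<nu> + 1) n x =
     (2 * \<nu> + 1) * (ultraspherical \<nu> n x - x * ultraspherical \<nu> (Suc n) x)"
proof -
  define m where "m = real n"
  define c0 c1 c' where "c0 = pochhammer (2 * \<nu>) n / fact n"
    and "c1 = pochhammer (2 * \<nu>) (Suc n) / fact (Suc n)"
    and "c' = pochhammer (2 * (\<nu> + 1)) n / fact n"
  have m: "m \<ge> 0" and c: "c1 > 0" using assms unfolding m_def c1_def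
    by (auto intro!: pochhammer_pos divide_pos_pos simp del: fact_Suc pochhammer_Suc)
  have c1: "(m + 1) * c1 = c0 * (2 * \<nu> + m)"
    using m by (simp add: c0_def c1_def pochhammer_Suc m_def divide_simps)
  have c': "2 * \<nu> * (2 * \<nu> + 1) * c' = (m + 1) * (m + 1 + 2 * \<nu>) * c1"
    unfolding c'_def c1_def m_def by (rule pochhammer_index_shift)
  define W0 W1 V where "W0 = ultraspherical \<nu> n x" and "W1 = ultraspherical \<nu> (Suc n) x"
    and "V = ultraspherical (\<nu> + 1) n x"
  have "2 * \<nu> * (1 - x\<^sup>2) * (c' * V) = (m + 2 * \<nu>) * (c0 * W0) - (m + 1) * x * (c1 * W1)"
    using gegenbauer_structure[OF assms, of x n] assms
    unfolding gegenbauer_eq_ultraspherical[OF assms] m_def c0_def c1_def c'_def W0_def W1_def V_def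
    by (subst (asm) gegenbauer_eq_ultraspherical) auto
  with c1 c' have "(m + 1) * c1 * ((1 - x\<^sup>2) * (m + 1 + 2 * \<nu>) * V) =
      (m + 1) * c1 * ((2 * \<nu> + 1) * (W0 - x * W1))"
    by algebra
  moreover have "(m + 1) * c1 \<noteq> 0" using c m by simp
  ultimately show ?thesis unfolding W0_def W1_def V_def m_def using mult_left_cancel by blast
qed

lemma has_real_derivative_ultraspherical:
  assumes "\<nu> > 0"
  shows "(ultraspherical \<nu> (Suc n) has_real_derivative
     (real n + 1) * (real n + 1 + 2 * \<nu>) / (2 * \<nu> + 1) * ultraspherical (\<nu> + 1) n x) (at x)"
proof -
  define c where "c = poly (gegenbauer_poly \<nu> (Suc n)) 1"
  have ceq: "c = pochhammer (2 * \<nu>) (Suc n) / fact (Suc n)"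
    unfolding c_def by (rule poly_gegenbauer_1)
  then have c: "c > 0" using assms
    by (auto intro!: pochhammer_pos divide_pos_pos simp del: fact_Suc pochhammer_Suc)
  have "(ultraspherical \<nu> (Suc n) has_real_derivative 2 * \<nu> * gegenbauer (\<nu> + 1) n x / c) (at x)"
    using DERIV_cdivide[OF poly_DERIV[of "gegenbauer_poly \<nu> (Suc n)" x], of c]
    unfolding poly_pderiv_gegenbauer[OF assms] c_def by (simp add: ultraspherical_def[abs_def] del: gegenbauer_poly.simps)
  also have "2 * \<nu> * gegenbauer (\<nu> + 1) n x / c =
      (real n + 1) * (real n + 1 + 2 * \<nu>) / (2 * \<nu> + 1) * ultraspherical (\<nu> + 1) n x"
  proof -
    define c' where "c' = pochhammer (2 * (\<nu> + 1)) n / fact n"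
    have "2 * \<nu> * (2 * \<nu> + 1) * c' = (real n + 1) * (real n + 1 + 2 * \<nu>) * c"
      unfolding ceq c'_def by (rule pochhammer_index_shift)
    moreover have "gegenbauer (\<nu> + 1) n x = c' * ultraspherical (\<nu> + 1) n x"
      unfolding c'_def using assms by (intro gegenbauer_eq_ultraspherical) simp
    ultimately have "(2 * \<nu> * gegenbauer (\<nu> + 1) n x) * (2 * \<nu> + 1) =
        ((real n + 1) * (real n + 1 + 2 * \<nu>) * ultraspherical (\<nu> + 1) n x) * c"
      by algebra
    then show ?thesis using c assms by (simp add: frac_eq_eq)
  qed
  finally show ?thesis .
qed

text \<open>
  For \<open>v = cos \<psi>\<close> the expression is the spherical law of cosines, so it is itself a cosine; here it
  follows from \<open>2ab \<le> a\<^sup>2 + b\<^sup>2\<close>.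
\<close>

lemma spherical_triangle_bound:
  fixes x y v :: real
  assumes "x \<in> {-1..1}" "y \<in> {-1..1}" "v \<in> {-1..1}"
  shows "x * y + sqrt (1 - x\<^sup>2) * sqrt (1 - y\<^sup>2) * v \<in> {-1..1}"
proof -
  define s t where "s = sqrt (1 - x\<^sup>2)" and "t = sqrt (1 - y\<^sup>2)"
  have sq: "x\<^sup>2 \<le> 1" "y\<^sup>2 \<le> 1" using assms by (auto simp: abs_square_le_1 abs_le_iff)
  then have st: "s\<^sup>2 = 1 - x\<^sup>2" "t\<^sup>2 = 1 - y\<^sup>2" "s \<ge> 0" "t \<ge> 0" by (auto simp: s_def t_def)
  have "\<bar>x * y + s * t * v\<bar> \<le> \<bar>x\<bar> * \<bar>y\<bar> + s * t * \<bar>v\<bar>"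
    using abs_triangle_ineq[of "x * y" "s * t * v"] st by (simp add: abs_mult)
  also have "\<dots> \<le> \<bar>x\<bar> * \<bar>y\<bar> + s * t"
    using st assms(3) mult_right_le_one_le[of "s * t" "\<bar>v\<bar>"] by (simp add: abs_le_iff)
  also have "\<dots> \<le> (x\<^sup>2 + y\<^sup>2) / 2 + (s\<^sup>2 + t\<^sup>2) / 2"
    using sum_squares_bound[of "\<bar>x\<bar>" "\<bar>y\<bar>"] sum_squares_bound[of s t] by (simp add: field_simps)
  also have "\<dots> = 1" using st by (simp add: field_simps)
  finally show ?thesis unfolding s_def t_def by (simp add: abs_le_iff)
qed

text \<open>
  Induction on the degree, simultaneously for all \<open>\<nu>\<close>. With \<open>z = xy + stv\<close>, where
  \<open>s = \<surd>(1 - x\<^sup>2)\<close> and \<open>t = \<surd>(1 - y\<^sup>2)\<close>, the three-term recurrence at \<open>z\<close>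
  expresses the integral for degree \<open>n + 2\<close> by those for \<open>n + 1\<close> and \<open>n\<close> and by
  \<open>J = \<integral> v W\<^sub>n\<^sub>+\<^sub>1(z)\<close>. Integration by parts turns \<open>J\<close> into \<open>st\<close> times the integral for index
  \<open>\<nu> + 1\<close> and degree \<open>n\<close>, known by induction. The resulting factor \<open>s\<^sup>2t\<^sup>2\<close> in \<open>st J\<close> is
  absorbed by the structure relation in \<open>x\<close> and in \<open>y\<close>.
\<close>

theorem ultraspherical_product_formula:
  assumes "\<nu> > 0" and x: "x \<in> {-1..1}" and y: "y \<in> {-1..1}"
  shows "(\<integral>v. ultraspherical \<nu> n (x * y + sqrt (1 - x\<^sup>2) * sqrt (1 - y\<^sup>2) * v)
            \<partial>gegenbauer_measure (\<nu> - 1/2)) = ultraspherical \<nu> n x * ultraspherical \<nu> n y"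
  using assms(1)
proof (induction n arbitrary: \<nu> rule: induct_nat_012)
  case 0
  interpret prob_space "gegenbauer_measure (\<nu> - 1/2)"
    by (rule prob_space_gegenbauer_measure) fact
  show ?case by (simp add: prob_space)
next
  case 1
  interpret prob_space "gegenbauer_measure (\<nu> - 1/2)"
    by (rule prob_space_gegenbauer_measure) fact
  have i: "integrable (gegenbauer_measure (\<nu> - 1/2)) (\<lambda>v. v)"
    by (intro gegenbauer_measure_integrable_continuous 1 continuous_intros)
  have "(\<integral>v. v * 1 \<partial>gegenbauer_measure (\<nu> - 1/2)) =
      (\<integral>v. 0 \<partial>gegenbauer_measure (\<nu> + 1 - 1/2)) / (2 * \<nu> + 1)"
    by (rule gegenbauer_measure_by_parts) (auto intro!: 1 derivative_eq_intros)
  then have "(\<integral>v. v \<partial>gegenbauer_measure (\<nu> - 1/2)) = 0" by simp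
  then show ?case using 1 i by (simp add: ultraspherical_Suc_0 prob_space)
next
  case (ge2 n)
  define m where "m = real n"
  have m: "m \<ge> 0" by (simp add: m_def)
  define s t where "s = sqrt (1 - x\<^sup>2)" and "t = sqrt (1 - y\<^sup>2)"
  have s: "s\<^sup>2 = 1 - x\<^sup>2" "t\<^sup>2 = 1 - y\<^sup>2"
    using x y by (auto simp: s_def t_def abs_square_le_1 abs_le_iff)
  define z where "z = (\<lambda>v. x * y + s * t * v)"
  let ?G = "gegenbauer_measure (\<nu> - 1/2)"
  let ?G' = "gegenbauer_measure (\<nu> + 1 - 1/2)"
  define W where "W = ultraspherical \<nu>"
  define V where "V = ultraspherical (\<nu> + 1)"
  have zc: "continuous_on UNIV z" unfolding z_def by (intro continuous_intros)
  have int [simp]: "integrable ?G (\<lambda>v. W k (z v))" "integrable ?G (\<lambda>v. v * W k (z v))" for k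
    unfolding W_def by (intro gegenbauer_measure_integrable_continuous ge2 continuous_intros zc)+
  define J where "J = (\<integral>v. v * W (Suc n) (z v) \<partial>?G)"
  have "J = (\<integral>v. s * t * ((m + 1) * (m + 1 + 2 * \<nu>) / (2 * \<nu> + 1) * V n (z v)) \<partial>?G') / (2 * \<nu> + 1)"
    unfolding J_def
  proof (rule gegenbauer_measure_by_parts)
    fix v
    have "(z has_real_derivative s * t) (at v)"
      unfolding z_def by (auto intro!: derivative_eq_intros)
    from DERIV_chain2[OF has_real_derivative_ultraspherical[OF \<open>\<nu> > 0\<close>] this, of n]
    show "((\<lambda>v. W (Suc n) (z v)) has_real_derivative
       s * t * ((m + 1) * (m + 1 + 2 * \<nu>) / (2 * \<nu> + 1) * V n (z v))) (at v)"
      by (simp add: W_def V_def m_def mult_ac)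
  next
    show "continuous_on UNIV (\<lambda>v. s * t * ((m + 1) * (m + 1 + 2 * \<nu>) / (2 * \<nu> + 1) * V n (z v)))"
      unfolding V_def by (intro continuous_intros zc)
  qed (fact ge2)
  also have "(\<integral>v. s * t * ((m + 1) * (m + 1 + 2 * \<nu>) / (2 * \<nu> + 1) * V n (z v)) \<partial>?G') =
      s * t * ((m + 1) * (m + 1 + 2 * \<nu>) / (2 * \<nu> + 1) * (V n x * V n y))"
    using ge2(1)[of "\<nu> + 1"] ge2(3) by (simp add: V_def z_def s_def t_def)
  finally have J0: "J = s * t * ((m + 1) * (m + 1 + 2 * \<nu>) / (2 * \<nu> + 1) * (V n x * V n y)) / (2 * \<nu> + 1)" .
  have cancel: "d\<^sup>2 * (a * (b / d * e) / d) = a * (b * e)" if "d \<noteq> 0" for a b d e :: real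
    using that by (simp add: power2_eq_square)
  have J: "(2 * \<nu> + 1)\<^sup>2 * J = s * t * ((m + 1) * (m + 1 + 2 * \<nu>) * (V n x * V n y))"
    unfolding J0 by (rule cancel) (use ge2(3) in simp)
  have I0: "(\<integral>v. W n (z v) \<partial>?G) = W n x * W n y"
    using ge2(1)[of \<nu>] ge2(3) by (simp add: W_def z_def s_def t_def)
  have I1: "(\<integral>v. W (Suc n) (z v) \<partial>?G) = W (Suc n) x * W (Suc n) y"
    using ge2(2)[of \<nu>] ge2(3) by (simp add: W_def z_def s_def t_def)
  have rec: "(m + 1 + 2 * \<nu>) * W (Suc (Suc n)) a = 2 * (m + 1 + \<nu>) * a * W (Suc n) a - (m + 1) * W n a" for a
    unfolding W_def m_def by (rule ultraspherical_rec) fact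
  have "(m + 1 + 2 * \<nu>) * (\<integral>v. W (Suc (Suc n)) (z v) \<partial>?G) =
      (\<integral>v. (m + 1 + 2 * \<nu>) * W (Suc (Suc n)) (z v) \<partial>?G)" by simp
  also have "\<dots> = (\<integral>v. 2 * (m + 1 + \<nu>) * (x * y) * W (Suc n) (z v)
      + 2 * (m + 1 + \<nu>) * (s * t) * (v * W (Suc n) (z v)) - (m + 1) * W n (z v) \<partial>?G)"
    unfolding rec by (intro Bochner_Integration.integral_cong) (auto simp: z_def algebra_simps)
  also have "\<dots> = 2 * (m + 1 + \<nu>) * (x * y) * (W (Suc n) x * W (Suc n) y)
      + 2 * (m + 1 + \<nu>) * (s * t) * J - (m + 1) * (W n x * W n y)"
    by (simp add: I0 I1 J_def)
  finally have E: "(m + 1 + 2 * \<nu>) * (\<integral>v. W (Suc (Suc n)) (z v) \<partial>?G) =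
      2 * (m + 1 + \<nu>) * (x * y) * (W (Suc n) x * W (Suc n) y)
      + 2 * (m + 1 + \<nu>) * (s * t) * J - (m + 1) * (W n x * W n y)" .
  \<comment> \<open>\<open>st J\<close> contains \<open>s\<^sup>2 V\<^sub>n(x) \<cdot> t\<^sup>2 V\<^sub>n(y)\<close>; the structure relation expresses both factors by index \<open>\<nu>\<close>\<close>
  have st: "(1 - a\<^sup>2) * (m + 1 + 2 * \<nu>) * V n a = (2 * \<nu> + 1) * (W n a - a * W (Suc n) a)" for a
    unfolding W_def V_def m_def by (rule ultraspherical_structure) fact
  have "(2 * \<nu> + 1)\<^sup>2 * ((m + 1 + 2 * \<nu>) * ((s * t) * J)) =
    (m + 1) * (((1 - x\<^sup>2) * (m + 1 + 2 * \<nu>) * V n x) * ((1 - y\<^sup>2) * (m + 1 + 2 * \<nu>) * V n y))"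
    using J s by algebra
  also have "\<dots> = (2 * \<nu> + 1)\<^sup>2 * ((m + 1) * ((W n x - x * W (Suc n) x) * (W n y - y * W (Suc n) y)))"
    unfolding st by (simp add: power2_eq_square)
  finally have J': "(m + 1 + 2 * \<nu>) * ((s * t) * J) =
      (m + 1) * ((W n x - x * W (Suc n) x) * (W n y - y * W (Suc n) y))"
    using ge2(3) by simp
  have "(m + 1 + 2 * \<nu>)\<^sup>2 * (\<integral>v. W (Suc (Suc n)) (z v) \<partial>?G) =
      (m + 1 + 2 * \<nu>)\<^sup>2 * (W (Suc (Suc n)) x * W (Suc (Suc n)) y)"
    using E J' rec[of x] rec[of y] by algebra
  moreover have "(m + 1 + 2 * \<nu>)\<^sup>2 \<noteq> 0" using m ge2(3) by auto
  ultimately have "(\<integral>v. W (Suc (Suc n)) (z v) \<partial>?G) = W (Suc (Suc n)) x * W (Suc (Suc n)) y"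
    using mult_left_cancel by blast
  then show ?case by (simp add: W_def z_def s_def t_def)
qed

text \<open>
  The product formula at \<open>x = y = z\<close>, where \<open>z\<close> maximises \<open>\<bar>W\<^sub>n\<bar>\<close> on \<open>[-1, 1]\<close> with
  maximum \<open>M\<close>, writes \<open>W\<^sub>n(z)\<^sup>2\<close> as an average of values of \<open>W\<^sub>n\<close>. So \<open>M\<^sup>2 \<le> M\<close>, hence \<open>M \<le> 1\<close>.
\<close>

lemma abs_ultraspherical_le_1:
  assumes nu: "\<nu> > 0" and x: "x \<in> {-1..1}"
  shows "\<bar>ultraspherical \<nu> n x\<bar> \<le> 1"
proof -
  interpret prob_space "gegenbauer_measure (\<nu> - 1/2)"
    by (rule prob_space_gegenbauer_measure) fact
  have "\<exists>z\<in>{-1..1}. \<forall>w\<in>{-1..1}. \<bar>ultraspherical \<nu> n w\<bar> \<le> \<bar>ultraspherical \<nu> n z\<bar>"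
    by (intro continuous_attains_sup continuous_intros) auto
  then obtain z where z: "z \<in> {-1..1}"
    and max: "\<And>w. w \<in> {-1..1} \<Longrightarrow> \<bar>ultraspherical \<nu> n w\<bar> \<le> \<bar>ultraspherical \<nu> n z\<bar>"
    by blast
  define M where "M = \<bar>ultraspherical \<nu> n z\<bar>"
  let ?f = "\<lambda>v. ultraspherical \<nu> n (z * z + sqrt (1 - z\<^sup>2) * sqrt (1 - z\<^sup>2) * v)"
  have int: "integrable (gegenbauer_measure (\<nu> - 1/2)) ?f"
    by (intro gegenbauer_measure_integrable_continuous nu continuous_intros)
  have "M\<^sup>2 = \<bar>\<integral>v. ?f v \<partial>gegenbauer_measure (\<nu> - 1/2)\<bar>"
    unfolding ultraspherical_product_formula[OF nu z z] M_def by (simp add: power2_eq_square abs_mult)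
  also have "\<dots> \<le> (\<integral>v. \<bar>?f v\<bar> \<partial>gegenbauer_measure (\<nu> - 1/2))"
    by (rule integral_abs_bound)
  also have "\<dots> \<le> (\<integral>v. M \<partial>gegenbauer_measure (\<nu> - 1/2))"
  proof (rule integral_mono_AE)
    show "AE v in gegenbauer_measure (\<nu> - 1/2). \<bar>?f v\<bar> \<le> M"
      using AE_gegenbauer_measure
    proof eventually_elim
      case (elim v)
      then show ?case unfolding M_def by (intro max spherical_triangle_bound z) auto
    qed
  qed (use int in auto)
  also have "\<dots> = M" by (simp add: prob_space)
  finally have "M * M \<le> 1 * M" by (simp add: power2_eq_square)
  then have "M \<le> 1"
    using mult_le_cancel_right[of M M 1] by (cases "M > 0") auto
  then show ?thesis using max[OF x] by (simp add: M_def)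
qed

section \<open>Sonine's integral\<close>

text \<open>
  A homogeneous form of \<open>W\<^sub>n\<^sup>\<nu>\<close>, of degree \<open>n\<close> when \<open>Y\<close> is given degree 2. The terms with
  \<open>2k > n\<close>, where the natural-number subtraction would truncate, vanish by their binomial coefficient.
\<close>

definition ultraspherical_hom :: "real \<Rightarrow> nat \<Rightarrow> real \<Rightarrow> real \<Rightarrow> real" where
  "ultraspherical_hom \<nu> n x Y = (\<Sum>k\<le>n. real (n choose (2 * k)) * (-1) ^ k *
     (pochhammer (1/2) k / pochhammer (\<nu> + 1/2) k) * x ^ (n - 2 * k) * Y ^ k)"

text \<open>
  Comparing coefficients of \<open>x\<^bsup>n + 2 - 2k\<^esup> Y\<^sup>k\<close> leaves an identity for binomial coefficients, which
  Pascal's rule and the absorption identity \<open>(2j + 1) (n + 1 choose 2j + 1) = (n + 1) (n choose 2j)\<close> prove.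
\<close>

lemma ultraspherical_hom_rec:
  assumes "\<nu> > 0"
  shows "(real n + 1 + 2 * \<nu>) * ultraspherical_hom \<nu> (Suc (Suc n)) x Y =
     2 * (real n + 1 + \<nu>) * x * ultraspherical_hom \<nu> (Suc n) x Y
     - (real n + 1) * (x\<^sup>2 + Y) * ultraspherical_hom \<nu> n x Y"
proof -
  define m where "m = (\<lambda>k. pochhammer (1/2) k / pochhammer (\<nu> + 1/2) k)"
  define t where "t = (\<lambda>n k. real (n choose (2 * k)) * (-1) ^ k * m k * x ^ (n - 2 * k) * Y ^ k)"
  define N where "N = Suc (Suc n)"
  have hom: "ultraspherical_hom \<nu> j x Y = (\<Sum>k\<le>K. t j k)" if "j \<le> K" for j K
    unfolding ultraspherical_hom_def t_def m_def
    by (rule sum.mono_neutral_left) (use that in \<open>auto simp: binomial_eq_0\<close>)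
  define e where "e = (\<lambda>k. x ^ (N - 2 * k) * Y ^ k)"
  have t2: "t N k = real (N choose (2 * k)) * (-1) ^ k * m k * e k" for k
    by (simp add: t_def e_def)
  have t1: "x * t (Suc n) k = real (Suc n choose (2 * k)) * (-1) ^ k * m k * e k" for k
  proof (cases "2 * k \<le> Suc n")
    case True
    then have "N - 2 * k = Suc (Suc n - 2 * k)" by (simp add: N_def)
    then show ?thesis by (simp add: t_def e_def)
  qed (simp add: t_def binomial_eq_0)
  have t0: "x\<^sup>2 * t n k = real (n choose (2 * k)) * (-1) ^ k * m k * e k" for k
  proof (cases "2 * k \<le> n")
    case True
    then have "N - 2 * k = Suc (Suc (n - 2 * k))" by (simp add: N_def)
    then show ?thesis by (simp add: t_def e_def power2_eq_square)
  qed (simp add: t_def binomial_eq_0)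
  have tY: "Y * t n k = real (n choose (2 * k)) * (-1) ^ k * m k * e (Suc k)" for k
    by (simp add: t_def e_def N_def)
  define g where "g = (\<lambda>k. case k of 0 \<Rightarrow> 0 | Suc j \<Rightarrow> Y * t n j)"
  have "Y * ultraspherical_hom \<nu> n x Y = (\<Sum>k\<le>Suc n. Y * t n k)"
    by (simp add: hom[of n "Suc n"] sum_distrib_left distrib_left del: sum.atMost_Suc)
  also have "\<dots> = (\<Sum>k\<le>N. g k)"
    unfolding N_def by (subst sum.atMost_Suc_shift) (simp add: g_def del: sum.atMost_Suc)
  finally have HY: "Y * ultraspherical_hom \<nu> n x Y = (\<Sum>k\<le>N. g k)" .
  have coeff: "(real n + 1 + 2 * \<nu>) * t N k = 2 * (real n + 1 + \<nu>) * (x * t (Suc n) k)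
      - (real n + 1) * (x\<^sup>2 * t n k) - (real n + 1) * g k" for k
  proof (cases k)
    case 0
    then show ?thesis unfolding t0 t1 t2 by (simp add: g_def m_def algebra_simps)
  next
    case (Suc j)
    define a b d where "a = real (n choose (2 * j))" and "b = real (n choose (Suc (2 * j)))"
      and "d = real (n choose (Suc (Suc (2 * j))))"
    have c1: "real (Suc n choose (2 * k)) = b + d" and c2: "real (N choose (2 * k)) = a + 2 * b + d"
      and c0: "real (n choose (2 * k)) = d"
      by (simp_all add: Suc N_def a_def b_def d_def)
    have "Suc (2 * j) * (Suc n choose Suc (2 * j)) = Suc n * (n choose (2 * j))"
      by (rule Suc_times_binomial)
    then have "real (Suc (2 * j) * (Suc n choose Suc (2 * j))) = real (Suc n * (n choose (2 * j)))"
      by (simp only:)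
    then have absorb: "(2 * real j + 1) * (a + b) = (real n + 1) * a"
      by (simp add: a_def b_def algebra_simps)
    have "pochhammer (\<nu> + 1/2) j > 0" using assms by (intro pochhammer_pos) simp
    then have mm: "(1/2 + real j) * m j = (\<nu> + 1/2 + real j) * m k"
      using assms by (simp add: m_def Suc pochhammer_Suc divide_simps)
    have "(real n + 1 + 2 * \<nu>) * ((a + 2 * b + d) * - m k) =
       2 * (real n + 1 + \<nu>) * ((b + d) * - m k) - (real n + 1) * (d * - m k) - (real n + 1) * (a * m j)"
      using absorb mm by algebra
    moreover define sg where "sg = (-1 :: real) ^ j"
    have gk: "g k = a * sg * m j * e k"
      by (simp add: g_def Suc tY a_def sg_def)
    have sk: "(-1 :: real) ^ k = - sg" by (simp add: Suc sg_def)
    ultimately show ?thesis unfolding t0 t1 t2 c0 c1 c2 gk sk by algebra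
  qed
  have "(real n + 1 + 2 * \<nu>) * ultraspherical_hom \<nu> N x Y = (\<Sum>k\<le>N. (real n + 1 + 2 * \<nu>) * t N k)"
    by (simp add: hom[of N N] sum_distrib_left del: sum.atMost_Suc)
  also have "\<dots> = 2 * (real n + 1 + \<nu>) * (x * (\<Sum>k\<le>N. t (Suc n) k))
      - (real n + 1) * (x\<^sup>2 * (\<Sum>k\<le>N. t n k)) - (real n + 1) * (\<Sum>k\<le>N. g k)"
    unfolding coeff sum_subtractf sum_distrib_left ..
  also have "\<dots> = 2 * (real n + 1 + \<nu>) * (x * ultraspherical_hom \<nu> (Suc n) x Y)
      - (real n + 1) * (x\<^sup>2 * ultraspherical_hom \<nu> n x Y) - (real n + 1) * (Y * ultraspherical_hom \<nu> n x Y)"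
    unfolding HY using hom[of "Suc n" N] hom[of n N] by (simp add: N_def del: sum.atMost_Suc)
  finally show ?thesis by (simp add: N_def algebra_simps)
qed

lemma ultraspherical_eq_hom:
  assumes "\<nu> > 0"
  shows "ultraspherical \<nu> n x = ultraspherical_hom \<nu> n x (1 - x\<^sup>2)"
proof (induction n rule: induct_nat_012)
  case 0
  show ?case by (simp add: ultraspherical_hom_def)
next
  case 1
  show ?case using assms by (simp add: ultraspherical_hom_def ultraspherical_Suc_0)
next
  case (ge2 n)
  have "(real n + 1 + 2 * \<nu>) * ultraspherical \<nu> (Suc (Suc n)) x =
      (real n + 1 + 2 * \<nu>) * ultraspherical_hom \<nu> (Suc (Suc n)) x (1 - x\<^sup>2)"
    unfolding ultraspherical_rec[OF assms] ultraspherical_hom_rec[OF assms] ge2 by simp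
  then show ?case using assms by simp
qed

text \<open>
  The homogeneity of the form: \<open>x / \<rho>\<close> satisfies \<open>1 - (x / \<rho>)\<^sup>2 = (\<rho>\<^sup>2 - x\<^sup>2) / \<rho>\<^sup>2\<close>.
  For the radius of Sonine's integral, the second argument becomes \<open>u\<^sup>2 (1 - x\<^sup>2)\<close>, which makes the
  dependence on \<open>u\<close> polynomial.
\<close>

lemma power_times_ultraspherical_div:
  assumes "\<nu> > 0" "\<rho> > 0"
  shows "\<rho> ^ n * ultraspherical \<nu> n (x / \<rho>) = ultraspherical_hom \<nu> n x (\<rho>\<^sup>2 - x\<^sup>2)"
proof -
  have scale: "\<rho> ^ n * (b * (x / \<rho>) ^ (n - 2 * k) * (1 - (x / \<rho>)\<^sup>2) ^ k) =
      b * x ^ (n - 2 * k) * (\<rho>\<^sup>2 - x\<^sup>2) ^ k" if "2 * k \<le> n \<or> b = 0" for k b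
  proof (cases "2 * k \<le> n")
    case True
    have 1: "\<rho> ^ n = \<rho> ^ (n - 2 * k) * (\<rho>\<^sup>2) ^ k"
      unfolding power_mult[symmetric] power_add[symmetric] using True by simp
    have "\<rho>\<^sup>2 * (1 - (x / \<rho>)\<^sup>2) = \<rho>\<^sup>2 - x\<^sup>2"
      using assms by (simp add: field_simps)
    then have 2: "(\<rho>\<^sup>2) ^ k * (1 - (x / \<rho>)\<^sup>2) ^ k = (\<rho>\<^sup>2 - x\<^sup>2) ^ k"
      unfolding power_mult_distrib[symmetric] by simp
    have 3: "\<rho> ^ (n - 2 * k) * (x / \<rho>) ^ (n - 2 * k) = x ^ (n - 2 * k)"
      unfolding power_mult_distrib[symmetric] using assms by simp
    have "\<rho> ^ n * (b * (x / \<rho>) ^ (n - 2 * k) * (1 - (x / \<rho>)\<^sup>2) ^ k) =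
        b * (\<rho> ^ (n - 2 * k) * (x / \<rho>) ^ (n - 2 * k)) * ((\<rho>\<^sup>2) ^ k * (1 - (x / \<rho>)\<^sup>2) ^ k)"
      unfolding 1 by (simp only: mult_ac)
    then show ?thesis unfolding 2 3 .
  qed (use that in simp)
  show ?thesis
    unfolding ultraspherical_eq_hom[OF assms(1)] ultraspherical_hom_def sum_distrib_left
    by (intro sum.cong refl scale) (auto simp: binomial_eq_0)
qed

definition sonine_radius :: "real \<Rightarrow> real \<Rightarrow> real" where
  "sonine_radius x u = sqrt (x\<^sup>2 - x\<^sup>2 * u\<^sup>2 + u\<^sup>2)"

lemma borel_measurable_sonine_radius [measurable]: "sonine_radius x \<in> borel_measurable borel"
  unfolding sonine_radius_def[abs_def] by measurable

lemma sonine_radius: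
  assumes "x \<in> {-1..1}" "u \<in> {0<..<1}"
  shows "sonine_radius x u > 0" "sonine_radius x u \<le> 1"
    "(sonine_radius x u)\<^sup>2 = x\<^sup>2 - x\<^sup>2 * u\<^sup>2 + u\<^sup>2"
    "(sonine_radius x u)\<^sup>2 - x\<^sup>2 = u\<^sup>2 * (1 - x\<^sup>2)" "1 - (sonine_radius x u)\<^sup>2 = (1 - x\<^sup>2) * (1 - u\<^sup>2)"
    "x / sonine_radius x u \<in> {-1..1}"
    "sqrt (1 - (x / sonine_radius x u)\<^sup>2) = u * sqrt (1 - x\<^sup>2) / sonine_radius x u"
proof -
  let ?r = "sonine_radius x u"
  have x: "x\<^sup>2 \<le> 1" using assms by (simp add: abs_square_le_1 abs_le_iff)
  have u: "u\<^sup>2 < 1" "u\<^sup>2 > 0" using assms by (simp_all add: abs_square_less_1 abs_less_iff)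
  have eq: "x\<^sup>2 - x\<^sup>2 * u\<^sup>2 + u\<^sup>2 = x\<^sup>2 * (1 - u\<^sup>2) + u\<^sup>2" by (simp add: algebra_simps)
  have pos: "x\<^sup>2 - x\<^sup>2 * u\<^sup>2 + u\<^sup>2 > 0"
    unfolding eq using u by (intro add_nonneg_pos) auto
  then show r: "?r > 0" by (simp add: sonine_radius_def)
  from pos show r2: "?r\<^sup>2 = x\<^sup>2 - x\<^sup>2 * u\<^sup>2 + u\<^sup>2" by (simp add: sonine_radius_def)
  then show r3: "?r\<^sup>2 - x\<^sup>2 = u\<^sup>2 * (1 - x\<^sup>2)" "1 - ?r\<^sup>2 = (1 - x\<^sup>2) * (1 - u\<^sup>2)"
    by (simp_all add: algebra_simps)
  have "?r\<^sup>2 \<le> 1" using r3(2) x u mult_nonneg_nonneg[of "1 - x\<^sup>2" "1 - u\<^sup>2"] by linarith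
  then show "?r \<le> 1" using r by (simp add: abs_square_le_1)
  have "x\<^sup>2 \<le> ?r\<^sup>2" using r3(1) x u mult_nonneg_nonneg[of "u\<^sup>2" "1 - x\<^sup>2"] by linarith
  then have "\<bar>x\<bar> \<le> ?r" using r power2_le_imp_le[of "\<bar>x\<bar>" ?r] by simp
  then show "x / ?r \<in> {-1..1}" using r by (simp add: abs_le_iff divide_le_eq le_divide_eq)
  have "1 - (x / ?r)\<^sup>2 = (?r\<^sup>2 - x\<^sup>2) / ?r\<^sup>2"
    using r by (simp add: power_divide diff_divide_distrib)
  then show "sqrt (1 - (x / ?r)\<^sup>2) = u * sqrt (1 - x\<^sup>2) / ?r"
    unfolding r3(1) using r u assms by (simp only: real_sqrt_divide real_sqrt_mult real_sqrt_abs) simp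
qed

text \<open>
  In the explicit form the index enters only through \<open>1 / (\<nu> + 1/2)\<^sub>k\<close>. The \<open>k\<close>-th term is multiplied by
  \<open>u\<^bsup>2k\<^esup>\<close>, whose mean \<open>(\<nu> + 1/2)\<^sub>k / (\<lambda> + 1/2)\<^sub>k\<close> replaces \<open>\<nu>\<close> by \<open>\<lambda>\<close>.
\<close>

theorem sonine_integral:
  assumes "0 < \<nu>" "\<nu> < lam" and x: "x \<in> {-1..1}"
  shows "(\<integral>u. sonine_radius x u ^ n * ultraspherical \<nu> n (x / sonine_radius x u) \<partial>sonine_measure \<nu> lam)
           = ultraspherical lam n x"
proof -
  have "(\<integral>u. sonine_radius x u ^ n * ultraspherical \<nu> n (x / sonine_radius x u) \<partial>sonine_measure \<nu> lam) =
     (\<integral>u. ultraspherical_hom \<nu> n x (u\<^sup>2 * (1 - x\<^sup>2)) \<partial>sonine_measure \<nu> lam)"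
  proof (rule integral_cong_AE)
    show "AE u in sonine_measure \<nu> lam. sonine_radius x u ^ n * ultraspherical \<nu> n (x / sonine_radius x u) =
        ultraspherical_hom \<nu> n x (u\<^sup>2 * (1 - x\<^sup>2))"
      using AE_sonine_measure
    proof eventually_elim
      case (elim u)
      show ?case using power_times_ultraspherical_div[OF assms(1) sonine_radius(1)[OF x elim], of n x]
        by (simp add: sonine_radius(4)[OF x elim])
    qed
  qed (simp_all add: ultraspherical_hom_def)
  also have "\<dots> = (\<Sum>k\<le>n. real (n choose (2 * k)) * (-1) ^ k *
     (pochhammer (1/2) k / pochhammer (\<nu> + 1/2) k) * x ^ (n - 2 * k) * (1 - x\<^sup>2) ^ k *
     (pochhammer (\<nu> + 1/2) k / pochhammer (lam + 1/2) k))"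
  proof (rule has_bochner_integral_integral_eq)
    have "has_bochner_integral (sonine_measure \<nu> lam)
      (\<lambda>u. \<Sum>k\<le>n. real (n choose (2 * k)) * (-1) ^ k *
     (pochhammer (1/2) k / pochhammer (\<nu> + 1/2) k) * x ^ (n - 2 * k) * (1 - x\<^sup>2) ^ k * u ^ (2 * k))
      (\<Sum>k\<le>n. real (n choose (2 * k)) * (-1) ^ k *
     (pochhammer (1/2) k / pochhammer (\<nu> + 1/2) k) * x ^ (n - 2 * k) * (1 - x\<^sup>2) ^ k *
     (pochhammer (\<nu> + 1/2) k / pochhammer (lam + 1/2) k))"
      by (intro has_bochner_integral_sum has_bochner_integral_mult_right
          has_bochner_integral_sonine_measure_moment assms)
    then show "has_bochner_integral (sonine_measure \<nu> lam)
      (\<lambda>u. ultraspherical_hom \<nu> n x (u\<^sup>2 * (1 - x\<^sup>2)))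
      (\<Sum>k\<le>n. real (n choose (2 * k)) * (-1) ^ k *
     (pochhammer (1/2) k / pochhammer (\<nu> + 1/2) k) * x ^ (n - 2 * k) * (1 - x\<^sup>2) ^ k *
     (pochhammer (\<nu> + 1/2) k / pochhammer (lam + 1/2) k))"
      by (simp add: ultraspherical_hom_def power_mult_distrib mult_ac flip: power_mult)
  qed
  also have "\<dots> = ultraspherical_hom lam n x (1 - x\<^sup>2)"
    unfolding ultraspherical_hom_def
  proof (intro sum.cong refl)
    fix k
    have "pochhammer (\<nu> + 1/2) k > 0" using assms by (intro pochhammer_pos) simp
    then show "real (n choose (2 * k)) * (-1) ^ k *
     (pochhammer (1/2) k / pochhammer (\<nu> + 1/2) k) * x ^ (n - 2 * k) * (1 - x\<^sup>2) ^ k *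
     (pochhammer (\<nu> + 1/2) k / pochhammer (lam + 1/2) k) =
     real (n choose (2 * k)) * (-1) ^ k *
     (pochhammer (1/2) k / pochhammer (lam + 1/2) k) * x ^ (n - 2 * k) * (1 - x\<^sup>2) ^ k"
      by simp
  qed
  also have "\<dots> = ultraspherical lam n x"
    using assms by (subst ultraspherical_eq_hom) auto
  finally show ?thesis .
qed

section \<open>The generating function and the Poisson kernel\<close>

lemma gegenbauer_weight_eq:
  assumes "\<nu> > 0"
  shows "gegenbauer_weight \<nu> n = (real n + \<nu>) / \<nu> * (pochhammer (2 * \<nu>) n / fact n)"
proof -
  have "2 * \<nu> \<notin> \<int>\<^sub>\<le>\<^sub>0" using assms nonpos_Ints_nonpos[of "2 * \<nu>"] by linarith
  then have "pochhammer (2 * \<nu>) n = Gamma (real n + 2 * \<nu>) / Gamma (2 * \<nu>)"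
    by (simp add: pochhammer_Gamma add.commute)
  then show ?thesis by (simp add: gegenbauer_weight_def)
qed

lemma gegenbauer_weight_pos: "\<nu> > 0 \<Longrightarrow> gegenbauer_weight \<nu> n > 0"
  by (auto simp: gegenbauer_weight_eq intro!: mult_pos_pos divide_pos_pos pochhammer_pos)

lemma gegenbauer_weight_times_ultraspherical:
  assumes "\<nu> > 0"
  shows "gegenbauer_weight \<nu> n * ultraspherical \<nu> n x = (real n + \<nu>) / \<nu> * gegenbauer \<nu> n x"
  by (simp add: gegenbauer_weight_eq gegenbauer_eq_ultraspherical assms)

lemma summable_gegenbauer_weight:
  assumes "\<nu> > 0" "\<bar>r\<bar> < 1"
  shows "summable (\<lambda>n. gegenbauer_weight \<nu> n * r ^ n)"
proof (rule summable_in_conv_radius)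
  have "conv_radius (gegenbauer_weight \<nu>) = ereal 1"
  proof (rule conv_radius_ratio_limit_nonzero[OF refl])
    have "norm (gegenbauer_weight \<nu> n) / norm (gegenbauer_weight \<nu> (Suc n)) =
        (real n + \<nu>) * (real n + 1) / ((real n + 1 + \<nu>) * (real n + 2 * \<nu>))" for n
    proof -
      have "pochhammer (2 * \<nu>) n > 0" using assms by (intro pochhammer_pos) simp
      then show ?thesis
        using gegenbauer_weight_pos[OF assms(1), of n] gegenbauer_weight_pos[OF assms(1), of "Suc n"] assms(1)
        by (simp add: gegenbauer_weight_eq pochhammer_Suc divide_simps add_pos_nonneg) (simp add: ac_simps)
    qed
    moreover have "(\<lambda>n. (real n + \<nu>) * (real n + 1) / ((real n + 1 + \<nu>) * (real n + 2 * \<nu>))) \<longlonglongrightarrow> 1"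
      by real_asymp
    ultimately show "(\<lambda>n. norm (gegenbauer_weight \<nu> n) / norm (gegenbauer_weight \<nu> (Suc n))) \<longlonglongrightarrow> 1"
      by simp
  qed simp
  then show "ereal (norm r) < conv_radius (gegenbauer_weight \<nu>)" using assms by simp
qed

lemma summable_abs_gegenbauer_weight:
  assumes "\<nu> > 0" "\<bar>r\<bar> < 1"
  shows "summable (\<lambda>n. \<bar>gegenbauer_weight \<nu> n * r ^ n\<bar>)"
  using summable_gegenbauer_weight[OF assms(1), of "\<bar>r\<bar>"] assms gegenbauer_weight_pos[OF assms(1)]
  by (simp add: abs_mult power_abs abs_of_pos)

lemma abs_gegenbauer_le_weight:
  assumes "\<nu> > 0" "x \<in> {-1..1}"
  shows "\<bar>gegenbauer \<nu> n x\<bar> \<le> gegenbauer_weight \<nu> n"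
proof -
  have p: "pochhammer (2 * \<nu>) n / fact n > (0::real)"
    using assms by (intro divide_pos_pos pochhammer_pos) auto
  have "\<bar>gegenbauer \<nu> n x\<bar> \<le> pochhammer (2 * \<nu>) n / fact n * 1"
    unfolding gegenbauer_eq_ultraspherical[OF assms(1)] abs_mult
    using p abs_ultraspherical_le_1[OF assms] by (intro mult_mono) auto
  also have "\<dots> \<le> (real n + \<nu>) / \<nu> * (pochhammer (2 * \<nu>) n / fact n)"
    using p assms mult_right_mono[of 1 "(real n + \<nu>) / \<nu>" "pochhammer (2 * \<nu>) n / fact n"] by simp
  finally show ?thesis by (simp add: gegenbauer_weight_eq assms)
qed

text \<open>
  The form is smallest at the end point of \<open>[-1, 1]\<close> that has the sign of \<open>z\<close>.
\<close>

lemma quadratic_form_ge: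
  fixes x z :: real
  assumes "x \<in> {-1..1}"
  shows "1 - 2 * z * x + z\<^sup>2 \<ge> (1 - \<bar>z\<bar>)\<^sup>2"
proof -
  have "z * x \<le> \<bar>z * x\<bar>" by simp
  also have "\<dots> \<le> \<bar>z\<bar> * 1"
    unfolding abs_mult using assms by (intro mult_left_mono) (auto simp: abs_le_iff)
  finally have "z * x \<le> \<bar>z\<bar>" by simp
  then show ?thesis by (simp add: power2_eq_square algebra_simps)
qed

text \<open>
  Multiplying the recurrence by \<open>z\<^bsup>n + 2\<^esup>\<close> and summing gives \<open>F'(z) D(z) = 2\<nu> (x - z) F(z)\<close> for the
  generating function \<open>F\<close>, with \<open>D(z) = 1 - 2zx + z\<^sup>2\<close>. So \<open>F \<cdot> D powr \<nu>\<close> is constant on \<open>(-1, 1)\<close>,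
  equal to its value 1 at 0. With \<open>F = D powr -\<nu>\<close> known, the equation becomes the second claim.
\<close>

lemma gegenbauer_series:
  assumes nu: "\<nu> > 0" and x: "x \<in> {-1..1}" and z: "\<bar>z\<bar> < 1"
  defines "D \<equiv> \<lambda>z. 1 - 2 * z * x + z\<^sup>2"
  shows gegenbauer_generating_function: "(\<lambda>n. gegenbauer \<nu> n x * z ^ n) sums D z powr -\<nu>" (is ?A)
    and gegenbauer_generating_function_deriv:
      "(\<lambda>n. real n * gegenbauer \<nu> n x * z ^ n) sums (2 * \<nu> * z * (x - z) * D z powr (-\<nu> - 1))" (is ?B)
proof -
  define C where "C = (\<lambda>n. gegenbauer \<nu> n x)"
  define F where "F = (\<lambda>z. \<Sum>n. C n * z ^ n)"
  define F' where "F' = (\<lambda>z. \<Sum>n. diffs C n * z ^ n)"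
  have D: "D w > 0" if "\<bar>w\<bar> < 1" for w
  proof -
    have "0 < (1 - \<bar>w\<bar>)\<^sup>2" using that by simp
    with quadratic_form_ge[OF x, of w] show ?thesis unfolding D_def by linarith
  qed
  have summ: "summable (\<lambda>n. C n * w ^ n)" if "\<bar>w\<bar> < 1" for w
  proof (rule summable_comparison_test')
    show "summable (\<lambda>n. gegenbauer_weight \<nu> n * \<bar>w\<bar> ^ n)"
      using summable_gegenbauer_weight[OF nu, of "\<bar>w\<bar>"] that by simp
    show "norm (C n * w ^ n) \<le> gegenbauer_weight \<nu> n * \<bar>w\<bar> ^ n" for n
      using abs_gegenbauer_le_weight[OF nu x, of n]
      by (simp add: abs_mult power_abs mult_right_mono C_def)
  qed
  have Fsums: "(\<lambda>n. C n * w ^ n) sums F w" if "\<bar>w\<bar> < 1" for w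
    unfolding F_def using summ[OF that] by (rule summable_sums)
  have dF: "(F has_real_derivative F' w) (at w)" if "\<bar>w\<bar> < 1" for w
    unfolding F_def F'_def
    by (rule termdiffs_strong'[where K = 1]) (use that summ in auto)
  have Asums: "(\<lambda>n. real n * C n * w ^ n) sums (w * F' w)" if "\<bar>w\<bar> < 1" for w
  proof -
    have "summable (\<lambda>n. diffs C n * w ^ n)"
      by (rule termdiff_converges[where K = 1]) (use that summ in auto)
    then have "(\<lambda>n. diffs C n * w ^ n) sums F' w" unfolding F'_def by (rule summable_sums)
    then have "(\<lambda>n. w * (diffs C n * w ^ n)) sums (w * F' w)" by (rule sums_mult)
    then have "(\<lambda>n. real (Suc n) * C (Suc n) * w ^ Suc n) sums (w * F' w)"
      by (simp add: diffs_def mult_ac)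
    then show ?thesis by (subst (asm) sums_Suc_iff) simp
  qed
  have ode: "w * F' w * D w = 2 * \<nu> * w * (x - w) * F w" if w: "\<bar>w\<bar> < 1" for w
  proof -
    let ?a = "\<lambda>n. real n * C n * w ^ n" and ?f = "\<lambda>n. C n * w ^ n"
    have a1: "(\<lambda>n. ?a (Suc n)) sums (w * F' w)"
      using Asums[OF w] by (subst sums_Suc_iff) simp
    have a2: "(\<lambda>n. ?a (Suc (Suc n))) sums (w * F' w - 2 * \<nu> * x * w)"
      using a1 by (subst sums_Suc_iff) (simp add: C_def)
    have f1: "(\<lambda>n. ?f (Suc n)) sums (F w - 1)"
      using Fsums[OF w] by (subst sums_Suc_iff) (simp add: C_def)
    have "(\<lambda>n. ?a (Suc (Suc n)) - 2 * x * w * ?a (Suc n) + w\<^sup>2 * ?a n) sums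
       (w * F' w - 2 * \<nu> * x * w - 2 * x * w * (w * F' w) + w\<^sup>2 * (w * F' w))"
      by (intro sums_add sums_diff sums_mult a1 a2 Asums[OF w])
    moreover have "(\<lambda>n. 2 * \<nu> * x * w * ?f (Suc n) - 2 * \<nu> * w\<^sup>2 * ?f n) sums
       (2 * \<nu> * x * w * (F w - 1) - 2 * \<nu> * w\<^sup>2 * F w)"
      by (intro sums_diff sums_mult f1 Fsums[OF w])
    moreover have "?a (Suc (Suc n)) - 2 * x * w * ?a (Suc n) + w\<^sup>2 * ?a n =
        2 * \<nu> * x * w * ?f (Suc n) - 2 * \<nu> * w\<^sup>2 * ?f n" for n
    proof -
      define m W where "m = real n" and "W = w ^ n"
      have "(m + 2) * C (Suc (Suc n)) = 2 * (m + 1 + \<nu>) * x * C (Suc n) - (m + 2 * \<nu>) * C n"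
        unfolding m_def C_def by (rule gegenbauer_rec)
      then have "(m + 2) * C (Suc (Suc n)) * (w * (w * W)) - 2 * x * w * ((m + 1) * C (Suc n) * (w * W))
        + w\<^sup>2 * (m * C n * W) = 2 * \<nu> * x * w * (C (Suc n) * (w * W)) - 2 * \<nu> * w\<^sup>2 * (C n * W)"
        by algebra
      then show ?thesis by (simp add: m_def W_def add_ac)
    qed
    ultimately have "w * F' w - 2 * \<nu> * x * w - 2 * x * w * (w * F' w) + w\<^sup>2 * (w * F' w) =
        2 * \<nu> * x * w * (F w - 1) - 2 * \<nu> * w\<^sup>2 * F w"
      by (simp only: sums_unique2)
    then show ?thesis unfolding D_def by algebra
  qed
  \<comment> \<open>at \<open>w = 0\<close> the factor \<open>w\<close> cannot be cancelled and the first two coefficients are compared directly\<close>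
  have ode': "F' w * D w = 2 * \<nu> * (x - w) * F w" if w: "\<bar>w\<bar> < 1" for w
  proof (cases "w = 0")
    case True
    have "F' 0 = diffs C 0" "F 0 = C 0"
      unfolding F'_def F_def using powser_zero[of "diffs C"] powser_zero[of C] by simp_all
    then show ?thesis using True by (simp add: D_def diffs_def C_def)
  next
    case False
    have "w * (F' w * D w) = w * (2 * \<nu> * (x - w) * F w)" using ode[OF w] by (simp add: mult_ac)
    then show ?thesis using False by simp
  qed
  have dD: "(D has_real_derivative - 2 * (x - w)) (at w)" for w
    unfolding D_def by (auto intro!: derivative_eq_intros)
  define H where "H = (\<lambda>w. F w * D w powr \<nu>)"
  have const: "\<exists>c. \<forall>w\<in>{-1<..<1}. H w = c"
  proof (rule has_field_derivative_zero_constant)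
    fix w :: real assume "w \<in> {-1<..<1}"
    then have w: "\<bar>w\<bar> < 1" by (simp add: abs_less_iff)
    have "(H has_real_derivative
        (F' w * D w powr \<nu> + F w * (\<nu> * D w powr (\<nu> - 1) * (- 2 * (x - w))))) (at w)"
      unfolding H_def using D[OF w]
      by (auto intro!: derivative_eq_intros dF[OF w] dD)
    also have "F' w * D w powr \<nu> + F w * (\<nu> * D w powr (\<nu> - 1) * (- 2 * (x - w))) =
        (F' w * D w - 2 * \<nu> * (x - w) * F w) * D w powr (\<nu> - 1)"
    proof -
      have "D w powr \<nu> = D w * D w powr (\<nu> - 1)"
        using D[OF w] by (simp add: powr_diff)
      then show ?thesis by (simp add: algebra_simps)
    qed
    also have "\<dots> = 0" using ode'[OF w] by simp
    finally show "(H has_real_derivative 0) (at w within {-1<..<1})"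
      by (rule has_field_derivative_at_within)
  qed simp
  obtain c where c: "\<And>w. w \<in> {-1<..<1} \<Longrightarrow> H w = c" using const by blast
  have "H 0 = 1"
    unfolding H_def F_def using powser_zero[of C] by (simp add: D_def C_def)
  moreover have "H z = H 0" using c[of z] c[of 0] z by (simp add: abs_less_iff)
  ultimately have "H z = 1" by simp
  then have Fz: "F z = D z powr -\<nu>"
    using D[OF z] by (simp add: H_def powr_minus field_simps)
  show ?A using Fsums[OF z] unfolding Fz C_def .
  have "z * F' z = 2 * \<nu> * z * (x - z) * F z / D z" using ode[OF z] D[OF z] by (simp add: field_simps)
  also have "\<dots> = 2 * \<nu> * z * (x - z) * D z powr (-\<nu> - 1)"
    unfolding Fz using D[OF z] by (simp add: powr_diff)
  finally have e: "z * F' z = 2 * \<nu> * z * (x - z) * D z powr (-\<nu> - 1)" .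
  show ?B using Asums[OF z] unfolding e unfolding C_def .
qed

text \<open>
  Since \<open>\<omega>\<^sub>n W\<^sub>n = (1 + n / \<nu>) C\<^sub>n\<close>, the series is \<open>F + z F' / \<nu>\<close> for the generating function \<open>F\<close>.
\<close>

theorem ultraspherical_poisson_kernel:
  assumes nu: "\<nu> > 0" and x: "x \<in> {-1..1}" and z: "\<bar>z\<bar> < 1"
  shows "(\<lambda>n. gegenbauer_weight \<nu> n * z ^ n * ultraspherical \<nu> n x) sums
           ((1 - z\<^sup>2) / (1 - 2 * z * x + z\<^sup>2) powr (\<nu> + 1))"
proof -
  define D where "D = 1 - 2 * z * x + z\<^sup>2"
  have "0 < (1 - \<bar>z\<bar>)\<^sup>2" using z by simp
  also have "\<dots> \<le> D" unfolding D_def by (rule quadratic_form_ge[OF x])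
  finally have D: "D > 0" .
  have "(\<lambda>n. gegenbauer \<nu> n x * z ^ n + 1 / \<nu> * (real n * gegenbauer \<nu> n x * z ^ n)) sums
      (D powr -\<nu> + 1 / \<nu> * (2 * \<nu> * z * (x - z) * D powr (-\<nu> - 1)))"
    unfolding D_def by (intro sums_add sums_mult gegenbauer_series assms)
  also have "(\<lambda>n. gegenbauer \<nu> n x * z ^ n + 1 / \<nu> * (real n * gegenbauer \<nu> n x * z ^ n)) =
      (\<lambda>n. gegenbauer_weight \<nu> n * z ^ n * ultraspherical \<nu> n x)"
  proof
    fix n
    have "gegenbauer_weight \<nu> n * z ^ n * ultraspherical \<nu> n x = (real n + \<nu>) / \<nu> * gegenbauer \<nu> n x * z ^ n"
      unfolding gegenbauer_weight_times_ultraspherical[OF nu, of n x, symmetric] by (simp only: mult_ac)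
    then show "gegenbauer \<nu> n x * z ^ n + 1 / \<nu> * (real n * gegenbauer \<nu> n x * z ^ n) =
       gegenbauer_weight \<nu> n * z ^ n * ultraspherical \<nu> n x"
      using nu by (simp add: field_simps)
  qed
  also have "D powr -\<nu> + 1 / \<nu> * (2 * \<nu> * z * (x - z) * D powr (-\<nu> - 1)) = (1 - z\<^sup>2) / D powr (\<nu> + 1)"
  proof -
    have "D powr -\<nu> = D * D powr (-\<nu> - 1)" using D by (simp add: powr_diff)
    moreover have "D powr (-\<nu> - 1) = 1 / D powr (\<nu> + 1)"
      using powr_minus_divide[of D "\<nu> + 1"] by simp
    moreover have "D + 2 * z * (x - z) = 1 - z\<^sup>2" by (simp add: D_def power2_eq_square algebra_simps)
    ultimately show ?thesis using nu by (simp add: add_divide_distrib[symmetric])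
  qed
  finally show ?thesis unfolding D_def .
qed

section \<open>The Askey-Fitch series for \<open>\<bar>r\<bar> < 1\<close>\<close>

text \<open>
  The partial sums are dominated by the constant \<open>\<Sum>n. \<bar>c n\<bar>\<close>, which a probability measure integrates.
\<close>

lemma (in prob_space) expectation_sums:
  fixes c :: "nat \<Rightarrow> real" and f :: "nat \<Rightarrow> 'a \<Rightarrow> real"
  assumes f [measurable]: "\<And>n. f n \<in> borel_measurable M" and g [measurable]: "g \<in> borel_measurable M"
    and bound: "\<And>n. AE x in M. \<bar>f n x\<bar> \<le> 1"
    and c: "summable (\<lambda>n. \<bar>c n\<bar>)"
    and sums: "AE x in M. (\<lambda>n. c n * f n x) sums g x"
  shows "integrable M g" "(\<lambda>n. c n * expectation (f n)) sums expectation g"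
proof -
  have int: "integrable M (f n)" for n
    using bound[of n] by (intro integrable_const_bound[of _ 1]) auto
  have summ_AE: "AE x in M. summable (\<lambda>n. norm (c n * f n x))"
  proof -
    have "AE x in M. \<forall>n. \<bar>f n x\<bar> \<le> 1" using bound by (simp add: AE_all_countable)
    then show ?thesis
    proof eventually_elim
      case (elim x)
      show ?case
        by (rule summable_comparison_test'[OF c])
           (use elim in \<open>auto simp: abs_mult intro!: mult_right_le_one_le\<close>)
    qed
  qed
  have summ_int: "summable (\<lambda>n. expectation (\<lambda>x. norm (c n * f n x)))"
  proof (rule summable_comparison_test'[OF c])
    fix n
    have "expectation (\<lambda>x. norm (c n * f n x)) = \<bar>c n\<bar> * expectation (\<lambda>x. \<bar>f n x\<bar>)"
      by (simp add: abs_mult)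
    also have "\<dots> \<le> \<bar>c n\<bar> * expectation (\<lambda>x. 1)"
      using int[of n] bound[of n] by (intro mult_left_mono integral_mono_AE) auto
    finally show "norm (expectation (\<lambda>x. norm (c n * f n x))) \<le> \<bar>c n\<bar>"
      by (simp add: prob_space integral_nonneg_AE)
  qed
  have eq: "AE x in M. (\<Sum>n. c n * f n x) = g x"
    using sums by eventually_elim (rule sums_unique[symmetric])
  have int': "integrable M (\<lambda>x. c n * f n x)" for n using int by simp
  have "integrable M (\<lambda>x. \<Sum>n. c n * f n x)"
    by (rule integrable_suminf[OF int' summ_AE summ_int])
  then show "integrable M g"
    using eq by (subst (asm) integrable_cong_AE) auto
  have "(\<lambda>n. expectation (\<lambda>x. c n * f n x)) sums expectation (\<lambda>x. \<Sum>n. c n * f n x)"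
    by (rule sums_integral[OF int' summ_AE summ_int])
  also have "expectation (\<lambda>x. \<Sum>n. c n * f n x) = expectation g"
    by (rule integral_cong_AE) (use eq in auto)
  finally show "(\<lambda>n. c n * expectation (f n)) sums expectation g" by simp
qed

lemma borel_measurable_askey_fitch_integrand [measurable (raw)]:
  assumes [measurable]: "f \<in> borel_measurable M" "g \<in> borel_measurable M"
  shows "(\<lambda>z. askey_fitch_integrand \<nu> x y r (f z) (g z)) \<in> borel_measurable M"
  unfolding askey_fitch_integrand_def askey_fitch_I_def by measurable

text \<open>
  This is \<open>\<zeta>\<close>, written in the form in which the product formula applies to \<open>x / \<rho>\<close> and \<open>y\<close>.
\<close>

definition sonine_point :: "real \<Rightarrow> real \<Rightarrow> real \<Rightarrow> real \<Rightarrow> real" where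
  "sonine_point x y u v = x / sonine_radius x u * y +
     sqrt (1 - (x / sonine_radius x u)\<^sup>2) * sqrt (1 - y\<^sup>2) * v"

lemma sonine_radius_times_point:
  assumes "x \<in> {-1..1}" "u \<in> {0<..<1}"
  shows "sonine_radius x u * sonine_point x y u v = x * y + u * v * sqrt (1 - x\<^sup>2) * sqrt (1 - y\<^sup>2)"
  using sonine_radius(1)[OF assms]
  unfolding sonine_point_def sonine_radius(7)[OF assms] by (simp add: distrib_left)

lemma askey_fitch_I_eq:
  assumes "x \<in> {-1..1}" "u \<in> {0<..<1}"
  shows "askey_fitch_I x y r u v =
    1 - 2 * (r * sonine_radius x u) * sonine_point x y u v + (r * sonine_radius x u)\<^sup>2"
proof -
  have "2 * (r * sonine_radius x u) * sonine_point x y u v = 2 * r * (sonine_radius x u * sonine_point x y u v)"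
    by simp
  also have "\<dots> = 2 * r * (x * y + u * v * sqrt (1 - x\<^sup>2) * sqrt (1 - y\<^sup>2))"
    unfolding sonine_radius_times_point[OF assms] ..
  finally show ?thesis
    unfolding askey_fitch_I_def power_mult_distrib sonine_radius(3)[OF assms] by linarith
qed

lemma askey_fitch_integrand_eq:
  assumes "x \<in> {-1..1}" "u \<in> {0<..<1}"
  shows "askey_fitch_integrand \<nu> x y r u v =
    (1 - (r * sonine_radius x u)\<^sup>2) / askey_fitch_I x y r u v powr (\<nu> + 1)"
  unfolding askey_fitch_integrand_def by (simp add: power_mult_distrib sonine_radius(3)[OF assms])

lemma sonine_point_in:
  assumes "x \<in> {-1..1}" "y \<in> {-1..1}" "u \<in> {0<..<1}" "v \<in> {-1..1}"
  shows "sonine_point x y u v \<in> {-1..1}"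
  unfolding sonine_point_def by (intro spherical_triangle_bound sonine_radius(6) assms)

text \<open>
  For fixed \<open>u\<close> the integrand is the Poisson series in \<open>r\<rho>\<close> at \<open>\<zeta>\<close>; it is integrated term by
  term with the product formula.
\<close>

lemma askey_fitch_inner:
  assumes nu: "0 < \<nu>" and x: "x \<in> {-1..1}" and y: "y \<in> {-1..1}" and r: "\<bar>r\<bar> < 1" and u: "u \<in> {0<..<1}"
  shows "integrable (gegenbauer_measure (\<nu> - 1/2)) (askey_fitch_integrand \<nu> x y r u)"
    "(\<lambda>n. gegenbauer_weight \<nu> n * r ^ n *
        (sonine_radius x u ^ n * ultraspherical \<nu> n (x / sonine_radius x u) * ultraspherical \<nu> n y)) sums
      (\<integral>v. askey_fitch_integrand \<nu> x y r u v \<partial>gegenbauer_measure (\<nu> - 1/2))"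
proof -
  interpret prob_space "gegenbauer_measure (\<nu> - 1/2)"
    by (rule prob_space_gegenbauer_measure) fact
  define z where "z = r * sonine_radius x u"
  have "\<bar>z\<bar> \<le> \<bar>r\<bar> * 1" unfolding z_def abs_mult
    using sonine_radius(1,2)[OF x u] by (intro mult_left_mono) auto
  then have z: "\<bar>z\<bar> < 1" using r by simp
  note sub = expectation_sums[of "\<lambda>n v. ultraspherical \<nu> n (sonine_point x y u v)"
      "askey_fitch_integrand \<nu> x y r u" "\<lambda>n. gegenbauer_weight \<nu> n * z ^ n"]
  have m1: "(\<lambda>v. ultraspherical \<nu> n (sonine_point x y u v)) \<in> borel_measurable (gegenbauer_measure (\<nu> - 1/2))" for n
    unfolding sonine_point_def by measurable
  have m2: "askey_fitch_integrand \<nu> x y r u \<in> borel_measurable (gegenbauer_measure (\<nu> - 1/2))"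
    by measurable
  have b: "AE v in gegenbauer_measure (\<nu> - 1/2). \<bar>ultraspherical \<nu> n (sonine_point x y u v)\<bar> \<le> 1" for n
    using AE_gegenbauer_measure
    by eventually_elim (intro abs_ultraspherical_le_1 nu sonine_point_in x y u, auto)
  have c: "summable (\<lambda>n. \<bar>gegenbauer_weight \<nu> n * z ^ n\<bar>)"
    by (rule summable_abs_gegenbauer_weight[OF nu z])
  have s: "AE v in gegenbauer_measure (\<nu> - 1/2).
      (\<lambda>n. gegenbauer_weight \<nu> n * z ^ n * ultraspherical \<nu> n (sonine_point x y u v)) sums
        askey_fitch_integrand \<nu> x y r u v"
    using AE_gegenbauer_measure
  proof eventually_elim
    case (elim v)
    then have "sonine_point x y u v \<in> {-1..1}" by (intro sonine_point_in x y u) auto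
    from ultraspherical_poisson_kernel[OF nu this z] show ?case
      unfolding askey_fitch_integrand_eq[OF x u] askey_fitch_I_eq[OF x u] z_def .
  qed
  show "integrable (gegenbauer_measure (\<nu> - 1/2)) (askey_fitch_integrand \<nu> x y r u)"
    by (rule sub(1)[OF m1 m2 b c s])
  have "(\<lambda>n. gegenbauer_weight \<nu> n * z ^ n * (\<integral>v. ultraspherical \<nu> n (sonine_point x y u v) \<partial>gegenbauer_measure (\<nu> - 1/2)))
     sums (\<integral>v. askey_fitch_integrand \<nu> x y r u v \<partial>gegenbauer_measure (\<nu> - 1/2))"
    by (rule sub(2)[OF m1 m2 b c s])
  then show "(\<lambda>n. gegenbauer_weight \<nu> n * r ^ n *
        (sonine_radius x u ^ n * ultraspherical \<nu> n (x / sonine_radius x u) * ultraspherical \<nu> n y)) sums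
      (\<integral>v. askey_fitch_integrand \<nu> x y r u v \<partial>gegenbauer_measure (\<nu> - 1/2))"
    unfolding sonine_point_def ultraspherical_product_formula[OF nu sonine_radius(6)[OF x u] y] z_def
    by (simp add: power_mult_distrib mult_ac)
qed

lemma borel_measurable_askey_fitch_inner:
  assumes "0 < \<nu>"
  shows "(\<lambda>u. \<integral>v. askey_fitch_integrand \<nu> x y r u v \<partial>gegenbauer_measure (\<nu> - 1/2)) \<in>
    borel_measurable (sonine_measure \<nu> lam)"
proof -
  interpret prob_space "gegenbauer_measure (\<nu> - 1/2)"
    by (rule prob_space_gegenbauer_measure) fact
  show ?thesis by measurable
qed

text \<open>
  The series for the inner integral is integrated term by term in \<open>u\<close> with Sonine's integral.
\<close>

theorem askey_fitch_inside:
  assumes nu: "0 < \<nu>" and lam: "\<nu> < lam" and x: "x \<in> {-1..1}" and y: "y \<in> {-1..1}" and r: "\<bar>r\<bar> < 1"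
  shows "AE u in sonine_measure \<nu> lam.
            integrable (gegenbauer_measure (\<nu> - 1/2)) (\<lambda>v. askey_fitch_integrand \<nu> x y r u v)"
    and "integrable (sonine_measure \<nu> lam)
            (\<lambda>u. \<integral>v. askey_fitch_integrand \<nu> x y r u v \<partial>gegenbauer_measure (\<nu> - 1/2))"
    and "(\<lambda>n. gegenbauer_weight \<nu> n * r ^ n * ultraspherical lam n x * ultraspherical \<nu> n y) sums
            (\<integral>u. (\<integral>v. askey_fitch_integrand \<nu> x y r u v \<partial>gegenbauer_measure (\<nu> - 1/2))
               \<partial>sonine_measure \<nu> lam)"
proof -
  let ?J = "\<lambda>u. \<integral>v. askey_fitch_integrand \<nu> x y r u v \<partial>gegenbauer_measure (\<nu> - 1/2)"
  let ?f = "\<lambda>n u. sonine_radius x u ^ n * ultraspherical \<nu> n (x / sonine_radius x u) * ultraspherical \<nu> n y"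
  interpret prob_space "sonine_measure \<nu> lam"
    by (rule prob_space_sonine_measure) fact+
  show "AE u in sonine_measure \<nu> lam.
            integrable (gegenbauer_measure (\<nu> - 1/2)) (\<lambda>v. askey_fitch_integrand \<nu> x y r u v)"
    using AE_sonine_measure by eventually_elim (rule askey_fitch_inner(1)[OF nu x y r])
  have m1: "?f n \<in> borel_measurable (sonine_measure \<nu> lam)" for n by measurable
  have m2: "?J \<in> borel_measurable (sonine_measure \<nu> lam)"
    by (rule borel_measurable_askey_fitch_inner[OF nu])
  have b: "AE u in sonine_measure \<nu> lam. \<bar>?f n u\<bar> \<le> 1" for n
    using AE_sonine_measure
  proof eventually_elim
    case (elim u)
    have "\<bar>sonine_radius x u ^ n\<bar> \<le> 1"
      using sonine_radius(1,2)[OF x elim] by (simp add: power_le_one)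
    moreover have "\<bar>ultraspherical \<nu> n (x / sonine_radius x u)\<bar> \<le> 1" "\<bar>ultraspherical \<nu> n y\<bar> \<le> 1"
      using abs_ultraspherical_le_1[OF nu sonine_radius(6)[OF x elim]] abs_ultraspherical_le_1[OF nu y] by auto
    ultimately show ?case unfolding abs_mult by (intro mult_le_one) auto
  qed
  have c: "summable (\<lambda>n. \<bar>gegenbauer_weight \<nu> n * r ^ n\<bar>)"
    by (rule summable_abs_gegenbauer_weight[OF nu r])
  have s: "AE u in sonine_measure \<nu> lam. (\<lambda>n. gegenbauer_weight \<nu> n * r ^ n * ?f n u) sums ?J u"
    using AE_sonine_measure by eventually_elim (rule askey_fitch_inner(2)[OF nu x y r])
  show "integrable (sonine_measure \<nu> lam) ?J"
    by (rule expectation_sums(1)[OF m1 m2 b c s])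
  have "(\<lambda>n. gegenbauer_weight \<nu> n * r ^ n * expectation (?f n)) sums expectation ?J"
    by (rule expectation_sums(2)[OF m1 m2 b c s])
  moreover have "expectation (?f n) = ultraspherical lam n x * ultraspherical \<nu> n y" for n
    using sonine_integral[OF nu lam x, of n] by (simp del: mult.assoc)
  ultimately show "(\<lambda>n. gegenbauer_weight \<nu> n * r ^ n * ultraspherical lam n x * ultraspherical \<nu> n y) sums expectation ?J"
    by (simp only: mult.assoc)
qed

section \<open>Decay of ultraspherical polynomials inside the interval\<close>

text \<open>
  The discrete Gronwall inequality: the product of the factors \<open>1 + a\<^sub>n\<close> is at most \<open>exp (\<Sum>n. a\<^sub>n)\<close>.
\<close>

lemma bounded_of_growth_factor:
  fixes E a :: "nat \<Rightarrow> real"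
  assumes E: "\<And>n. E n \<ge> 0" and a: "\<And>n. a n \<ge> 0" and sum: "summable a"
    and step: "\<And>n. E (Suc n) \<le> (1 + a n) * E n"
  shows "E n \<le> E 0 * exp (suminf a)"
proof -
  have "E n \<le> E 0 * exp (\<Sum>k<n. a k)"
  proof (induction n)
    case (Suc n)
    have "E (Suc n) \<le> exp (a n) * E n"
      using step[of n] mult_right_mono[OF exp_ge_add_one_self[of "a n"] E[of n]] by linarith
    also have "\<dots> \<le> exp (a n) * (E 0 * exp (\<Sum>k<n. a k))"
      by (intro mult_left_mono Suc) auto
    finally show ?case by (simp add: exp_add mult_ac)
  qed simp
  also have "\<dots> \<le> E 0 * exp (suminf a)"
    using sum_le_suminf[OF sum, of "{..<n}"] a E by (intro mult_left_mono) auto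
  finally show ?thesis .
qed

text \<open>
  Since \<open>(\<lambda>)\<^sub>n / n!\<close> has order \<open>n\<^bsup>\<lambda> - 1\<^esup>\<close> and \<open>C\<^sub>n(1)\<close> has order \<open>n\<^bsup>2\<lambda> - 1\<^esup>\<close>, this is the decay
  \<open>W\<^sub>n(x) = O(n\<^bsup>-\<lambda>\<^esup>)\<close>. Rescaled to leading coefficient \<open>2\<^sup>n\<close>, the polynomials \<open>p\<^sub>n\<close> satisfy
  \<open>p\<^sub>n\<^sub>+\<^sub>2 = 2x p\<^sub>n\<^sub>+\<^sub>1 - (1 - b\<^sub>n) p\<^sub>n\<close> with \<open>b\<^sub>n = O(1 / n\<^sup>2)\<close>, a summable perturbation of the
  recurrence of the Chebyshev polynomials. The quadratic form
  \<open>E\<^sub>n = p\<^sub>n\<^sub>+\<^sub>1\<^sup>2 - 2x p\<^sub>n\<^sub>+\<^sub>1 p\<^sub>n + p\<^sub>n\<^sup>2\<close> is conserved by the Chebyshev recurrence and positive definite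
  for \<open>\<bar>x\<bar> < 1\<close>, so here it changes by factors \<open>1 + O(\<bar>b\<^sub>n\<bar>)\<close> and stays bounded, and with it \<open>p\<^sub>n\<close>.
\<close>

lemma gegenbauer_bound_inside:
  assumes lam: "lam > 0" and x: "\<bar>x\<bar> < 1"
  shows "\<exists>K. \<forall>n. \<bar>gegenbauer lam n x\<bar> \<le> K * (pochhammer lam n / fact n)"
proof -
  define p where "p = (\<lambda>n. fact n / pochhammer lam n * gegenbauer lam n x)"
  define b where "b = (\<lambda>n. lam * (lam - 1) * (1 / (real n + lam) - 1 / (real n + 1 + lam)))"
  define E where "E = (\<lambda>n. (p (Suc n))\<^sup>2 - 2 * x * p (Suc n) * p n + (p n)\<^sup>2)"
  have poch: "pochhammer lam n > 0" for n using lam by (rule pochhammer_pos)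
  have rec: "p (Suc (Suc n)) = 2 * x * p (Suc n) - (1 - b n) * p n" for n
  proof -
    define m q f where "m = real n" and "q = pochhammer lam n" and "f = (fact n :: real)"
    have pos: "m \<ge> 0" "q > 0" "f > 0" "lam + m > 0" "lam + m + 1 > 0"
      using poch[of n] lam by (auto simp: m_def q_def f_def)
    define C0 C1 C2 where "C0 = gegenbauer lam n x" and "C1 = gegenbauer lam (Suc n) x"
      and "C2 = gegenbauer lam (Suc (Suc n)) x"
    have "(m + 2) * C2 = 2 * (m + 1 + lam) * x * C1 - (m + 2 * lam) * C0"
      unfolding m_def C0_def C1_def C2_def by (rule gegenbauer_rec)
    moreover have p0: "q * p n = f * C0"
      using pos by (simp add: p_def q_def f_def C0_def)
    moreover have p1: "q * (lam + m) * p (Suc n) = (m + 1) * f * C1"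
    proof -
      have "p (Suc n) = (m + 1) * f / (q * (lam + m)) * C1"
        by (simp add: p_def q_def f_def m_def C1_def pochhammer_Suc add_ac)
      then show ?thesis using pos by simp
    qed
    moreover have p2: "q * (lam + m) * (lam + m + 1) * p (Suc (Suc n)) = (m + 2) * (m + 1) * f * C2"
    proof -
      have "p (Suc (Suc n)) = (m + 2) * ((m + 1) * f) / (q * (lam + m) * (lam + m + 1)) * C2"
        by (simp add: p_def q_def f_def m_def C2_def pochhammer_Suc add_ac mult_ac)
      then show ?thesis using pos by simp
    qed
    moreover have bn: "(lam + m) * (lam + m + 1) * b n = lam * (lam - 1)"
    proof -
      have "b n = lam * (lam - 1) * (1 / (lam + m) - 1 / (lam + m + 1))"
        by (simp add: b_def m_def add_ac)
      also have "1 / (lam + m) - 1 / (lam + m + 1) = 1 / ((lam + m) * (lam + m + 1))"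
        using pos by (simp add: field_simps)
      finally show ?thesis using pos by simp
    qed
    ultimately have "q * (lam + m) * (lam + m + 1) * p (Suc (Suc n)) =
        q * (lam + m) * (lam + m + 1) * (2 * x * p (Suc n) - (1 - b n) * p n)"
      by algebra
    moreover have "q * (lam + m) * (lam + m + 1) \<noteq> 0" using pos by simp
    ultimately show ?thesis using mult_left_cancel by blast
  qed
  have diff_nonneg: "1 / (real n + lam) - 1 / (real n + 1 + lam) \<ge> 0" for n
    using lam by (simp add: frac_le)
  have b1: "\<bar>b n\<bar> \<le> 1" for n
  proof -
    have "1 / (real n + lam) - 1 / (real n + 1 + lam) = 1 / ((real n + lam) * (real n + 1 + lam))"
      using lam by (simp add: field_simps)
    also have "\<dots> \<le> 1 / (lam * (1 + lam))"
      using lam by (intro divide_left_mono mult_mono mult_pos_pos) auto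
    finally have "\<bar>b n\<bar> \<le> \<bar>lam * (lam - 1)\<bar> * (1 / (lam * (1 + lam)))"
      unfolding b_def abs_mult using diff_nonneg[of n] by (intro mult_left_mono) auto
    also have "\<dots> = \<bar>lam - 1\<bar> / (1 + lam)" using lam by (simp add: abs_mult)
    also have "\<dots> \<le> 1" using lam by simp
    finally show ?thesis .
  qed
  have sum_b: "summable (\<lambda>n. \<bar>b n\<bar>)"
  proof -
    have "(\<lambda>n. 1 / (real n + lam)) \<longlonglongrightarrow> 0" by real_asymp
    then have "summable (\<lambda>n. 1 / (real n + lam) - 1 / (real (Suc n) + lam))"
      by (rule telescope_summable')
    then have "summable (\<lambda>n. \<bar>lam * (lam - 1)\<bar> * (1 / (real n + lam) - 1 / (real (Suc n) + lam)))"
      by (rule summable_mult)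
    also have "(\<lambda>n. \<bar>lam * (lam - 1)\<bar> * (1 / (real n + lam) - 1 / (real (Suc n) + lam))) = (\<lambda>n. \<bar>b n\<bar>)"
      using diff_nonneg by (simp add: b_def abs_mult add_ac)
    finally show ?thesis .
  qed
  have lower: "(1 - \<bar>x\<bar>) * ((p n)\<^sup>2 + (p (Suc n))\<^sup>2) \<le> E n" for n
  proof -
    have "2 * x * p (Suc n) * p n \<le> \<bar>x\<bar> * (2 * \<bar>p (Suc n)\<bar> * \<bar>p n\<bar>)"
      using abs_ge_self[of "2 * x * p (Suc n) * p n"] by (simp add: abs_mult mult_ac)
    also have "\<dots> \<le> \<bar>x\<bar> * ((p (Suc n))\<^sup>2 + (p n)\<^sup>2)"
      using sum_squares_bound[of "\<bar>p (Suc n)\<bar>" "\<bar>p n\<bar>"] by (intro mult_left_mono) auto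
    finally show ?thesis by (simp add: E_def algebra_simps)
  qed
  define k where "k = 4 / (1 - \<bar>x\<bar>)"
  have k: "k > 0" using x by (simp add: k_def)
  have E0: "E n \<ge> 0" for n
  proof -
    have "0 \<le> (1 - \<bar>x\<bar>) * ((p n)\<^sup>2 + (p (Suc n))\<^sup>2)"
      using x by (intro mult_nonneg_nonneg) auto
    with lower[of n] show ?thesis by linarith
  qed
  have step: "E (Suc n) \<le> (1 + k * \<bar>b n\<bar>) * E n" for n
  proof -
    define S where "S = (p n)\<^sup>2 + (p (Suc n))\<^sup>2"
    have "E (Suc n) = E n + b n * (2 * x * (p n * p (Suc n)) + (b n - 2) * (p n)\<^sup>2)"
      unfolding E_def rec by (simp add: power2_eq_square algebra_simps)
    also have "\<dots> \<le> E n + \<bar>b n\<bar> * \<bar>2 * x * (p n * p (Suc n)) + (b n - 2) * (p n)\<^sup>2\<bar>"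
      using abs_ge_self[of "b n * (2 * x * (p n * p (Suc n)) + (b n - 2) * (p n)\<^sup>2)"] by (simp add: abs_mult)
    finally have 1: "E (Suc n) \<le> E n + \<bar>b n\<bar> * \<bar>2 * x * (p n * p (Suc n)) + (b n - 2) * (p n)\<^sup>2\<bar>" .
    have "\<bar>2 * x * (p n * p (Suc n)) + (b n - 2) * (p n)\<^sup>2\<bar> \<le> 4 * S"
    proof -
      have "\<bar>2 * x * (p n * p (Suc n))\<bar> = \<bar>x\<bar> * (2 * \<bar>p n\<bar> * \<bar>p (Suc n)\<bar>)"
        by (simp add: abs_mult)
      also have "\<dots> \<le> 1 * S"
        using x sum_squares_bound[of "\<bar>p n\<bar>" "\<bar>p (Suc n)\<bar>"] unfolding S_def
        by (intro mult_mono) auto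
      finally have 2: "\<bar>2 * x * (p n * p (Suc n))\<bar> \<le> S" by simp
      have "\<bar>b n - 2\<bar> \<le> 3" using b1[of n] by linarith
      then have "\<bar>(b n - 2) * (p n)\<^sup>2\<bar> \<le> 3 * (p n)\<^sup>2"
        unfolding abs_mult by (simp add: mult_right_mono)
      also have "\<dots> \<le> 3 * S" by (simp add: S_def)
      finally show ?thesis using 2 by linarith
    qed
    also have "4 * S \<le> k * E n"
      using lower[of n] x by (simp add: k_def S_def field_simps)
    finally have "\<bar>b n\<bar> * \<bar>2 * x * (p n * p (Suc n)) + (b n - 2) * (p n)\<^sup>2\<bar> \<le> \<bar>b n\<bar> * (k * E n)"
      by (intro mult_left_mono) auto
    with 1 have "E (Suc n) \<le> E n + \<bar>b n\<bar> * (k * E n)" by linarith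
    then show ?thesis by (simp add: algebra_simps)
  qed
  define B where "B = E 0 * exp (\<Sum>n. k * \<bar>b n\<bar>)"
  have EB: "E n \<le> B" for n unfolding B_def
    by (rule bounded_of_growth_factor) (use E0 k sum_b step in \<open>auto intro: summable_mult\<close>)
  define K where "K = sqrt (B / (1 - \<bar>x\<bar>))"
  have "\<bar>p n\<bar> \<le> K" for n
  proof -
    have "(1 - \<bar>x\<bar>) * (p n)\<^sup>2 \<le> (1 - \<bar>x\<bar>) * ((p n)\<^sup>2 + (p (Suc n))\<^sup>2)"
      using x by (intro mult_left_mono) auto
    also have "\<dots> \<le> B" using lower[of n] EB[of n] by linarith
    finally have "(p n)\<^sup>2 \<le> B / (1 - \<bar>x\<bar>)" using x by (simp add: field_simps)
    then show ?thesis unfolding K_def by (simp add: real_le_rsqrt flip: real_sqrt_abs)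
  qed
  then have "\<bar>gegenbauer lam n x\<bar> \<le> K * (pochhammer lam n / fact n)" for n
  proof -
    have "gegenbauer lam n x = p n * (pochhammer lam n / fact n)"
      using poch[of n] by (simp add: p_def)
    then have "\<bar>gegenbauer lam n x\<bar> = \<bar>p n\<bar> * (pochhammer lam n / fact n)"
      using poch[of n] by (simp add: abs_mult)
    also have "\<dots> \<le> K * (pochhammer lam n / fact n)"
      using \<open>\<bar>p n\<bar> \<le> K\<close> poch[of n] by (intro mult_right_mono) auto
    finally show ?thesis .
  qed
  then show ?thesis by blast
qed

text \<open>
  The terms have order \<open>n\<^bsup>\<nu> - \<lambda>\<^esup>\<close>. Their ratios are rational in \<open>n\<close>, so Raabe's test applies, with
  limit \<open>\<lambda> - \<nu> > 1\<close>.
\<close>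

lemma summable_pochhammer_ratio:
  assumes "\<nu> > 0" "\<nu> + 1 < lam"
  shows "summable (\<lambda>n. (real n + \<nu>) * (pochhammer \<nu> n / fact n) * (pochhammer lam n / pochhammer (2 * lam) n))"
    (is "summable ?f")
proof (rule raabes_test_convergence)
  have pos: "?f n > 0" for n
    using assms by (auto intro!: mult_pos_pos divide_pos_pos pochhammer_pos)
  then show "eventually (\<lambda>n. ?f n > 0) sequentially" by simp
  have ratio: "?f n / ?f (Suc n) = (real n + 1) * (real n + 2 * lam) / ((real n + 1 + \<nu>) * (real n + lam))" for n
  proof -
    define m a b c f where "m = real n" and "a = pochhammer \<nu> n" and "b = pochhammer lam n"
      and "c = pochhammer (2 * lam) n" and "f = (fact n :: real)"
    have pos: "m \<ge> 0" "a > 0" "b > 0" "c > 0" "f > 0"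
      using assms by (auto simp: m_def a_def b_def c_def f_def intro!: pochhammer_pos)
    have "?f n = (m + \<nu>) * (a / f) * (b / c)"
      by (simp add: m_def a_def b_def c_def f_def)
    moreover have "?f (Suc n) = (m + 1 + \<nu>) * (a * (m + \<nu>) / ((m + 1) * f)) * (b * (m + lam) / (c * (m + 2 * lam)))"
      by (simp add: m_def a_def b_def c_def f_def pochhammer_Suc add_ac)
    moreover have "(m + \<nu>) * (a / f) * (b / c) /
      ((m + 1 + \<nu>) * (a * (m + \<nu>) / ((m + 1) * f)) * (b * (m + lam) / (c * (m + 2 * lam)))) =
      (m + 1) * (m + 2 * lam) / ((m + 1 + \<nu>) * (m + lam))"
    proof -
      have "m + \<nu> \<noteq> 0" using pos assms by linarith
      then show ?thesis using pos by (simp add: mult_ac)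
    qed
    ultimately show ?thesis by (simp add: m_def)
  qed
  have "(\<lambda>n. real n * ((real n + 1) * (real n + 2 * lam) / ((real n + 1 + \<nu>) * (real n + lam)) - 1)) \<longlonglongrightarrow> lam - \<nu>"
    by real_asymp
  then have "(\<lambda>n. ereal (real n * (?f n / ?f (Suc n) - 1))) \<longlonglongrightarrow> ereal (lam - \<nu>)"
    unfolding ratio by simp
  then have "liminf (\<lambda>n. ereal (real n * (?f n / ?f (Suc n) - 1))) = ereal (lam - \<nu>)"
    by (intro lim_imp_Liminf) auto
  then show "1 < liminf (\<lambda>n. ereal (real n * (?f n / ?f (Suc n) - 1)))"
    using assms by (simp add: one_ereal_def)
qed

lemma summable_askey_fitch_boundary:
  assumes nu: "0 < \<nu>" and lam: "\<nu> + 1 < lam" and x: "\<bar>x\<bar> < 1" and y: "\<bar>y\<bar> < 1"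
  shows "summable (\<lambda>n. \<bar>gegenbauer_weight \<nu> n * ultraspherical lam n x * ultraspherical \<nu> n y\<bar>)"
proof -
  have lam0: "lam > 0" using nu lam by simp
  obtain K where K: "\<And>n. \<bar>gegenbauer lam n x\<bar> \<le> K * (pochhammer lam n / fact n)"
    using gegenbauer_bound_inside[OF lam0 x] by blast
  obtain L where L: "\<And>n. \<bar>gegenbauer \<nu> n y\<bar> \<le> L * (pochhammer \<nu> n / fact n)"
    using gegenbauer_bound_inside[OF nu y] by blast
  show ?thesis
  proof (rule summable_comparison_test')
    show "summable (\<lambda>n. K * L / \<nu> * ((real n + \<nu>) * (pochhammer \<nu> n / fact n) * (pochhammer lam n / pochhammer (2 * lam) n)))"
      by (intro summable_mult summable_pochhammer_ratio nu lam)
    fix n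
    have poch: "pochhammer lam n > 0" "pochhammer (2 * lam) n > 0" "pochhammer \<nu> n > 0"
      using lam0 nu by (auto intro!: pochhammer_pos)
    have K0: "K \<ge> 0" and L0: "L \<ge> 0" using K[of 0] L[of 0] by simp_all
    have "gegenbauer_weight \<nu> n * ultraspherical lam n x * ultraspherical \<nu> n y =
        (real n + \<nu>) / \<nu> * gegenbauer \<nu> n y * (gegenbauer lam n x * (fact n / pochhammer (2 * lam) n))"
    proof -
      have "ultraspherical lam n x = gegenbauer lam n x * (fact n / pochhammer (2 * lam) n)"
        using gegenbauer_eq_ultraspherical[OF lam0, of n x] poch by simp
      then show ?thesis
        unfolding gegenbauer_weight_times_ultraspherical[OF nu, of n y, symmetric] by (simp only: mult_ac)
    qed
    then have "\<bar>gegenbauer_weight \<nu> n * ultraspherical lam n x * ultraspherical \<nu> n y\<bar> =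
        (real n + \<nu>) / \<nu> * \<bar>gegenbauer \<nu> n y\<bar> * (\<bar>gegenbauer lam n x\<bar> * (fact n / pochhammer (2 * lam) n))"
      using nu poch by (simp add: abs_mult)
    also have "\<dots> \<le> (real n + \<nu>) / \<nu> * (L * (pochhammer \<nu> n / fact n)) *
        ((K * (pochhammer lam n / fact n)) * (fact n / pochhammer (2 * lam) n))"
      using nu poch K0 L0 by (intro mult_mono K L mult_nonneg_nonneg) auto
    also have "\<dots> = K * L / \<nu> * ((real n + \<nu>) * (pochhammer \<nu> n / fact n) * (pochhammer lam n / pochhammer (2 * lam) n))"
      by (simp add: mult_ac)
    finally show "norm \<bar>gegenbauer_weight \<nu> n * ultraspherical lam n x * ultraspherical \<nu> n y\<bar> \<le>
       K * L / \<nu> * ((real n + \<nu>) * (pochhammer \<nu> n / fact n) * (pochhammer lam n / pochhammer (2 * lam) n))"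
      by simp
  qed
qed

section \<open>The boundary case \<open>r = 1\<close>\<close>

text \<open>
  With \<open>z = r\<rho>\<close>, \<open>s = \<surd>(1 - x\<^sup>2)\<close> and \<open>t = \<surd>(1 - y\<^sup>2)\<close> the denominator base is
  \<open>I = (1 - z)\<^sup>2 + 2z (1 - \<zeta>)\<close>. The first summand controls \<open>u\<close>, because
  \<open>1 - z \<ge> 1 - \<rho> \<ge> s\<^sup>2 (1 - u\<^sup>2) / 2\<close>. The second controls \<open>v\<close>, because
  \<open>\<rho> (1 - \<zeta>) \<ge> ust (1 - v)\<close>. The numerator gains half a power:
  \<open>1 - z\<^sup>2 \<le> 2 (1 - z) \<le> 2 \<surd>I\<close>. This leaves \<open>2 I powr -(\<nu> + 1/2)\<close>, whose exponent is split as
  \<open>p + q\<close> between the two lower bounds.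
\<close>

lemma askey_fitch_majorant:
  assumes nu: "0 < \<nu>" and x: "\<bar>x\<bar> < 1" and y: "\<bar>y\<bar> < 1" and p: "p \<ge> 0" and q: "q \<ge> 0" and pq: "p + q = \<nu> + 1/2"
  obtains K where "\<And>r u v. r \<in> {1/2..1} \<Longrightarrow> u \<in> {0<..<1} \<Longrightarrow> v \<in> {-1<..<1} \<Longrightarrow>
     askey_fitch_I x y r u v > 0 \<and>
     \<bar>askey_fitch_integrand \<nu> x y r u v\<bar> \<le>
       K * (u powr -q * (1 - u\<^sup>2) powr (-2 * p)) * (1 - v\<^sup>2) powr -q"
proof
  fix r u v :: real
  assume r: "r \<in> {1/2..1}" and u: "u \<in> {0<..<1}" and v: "v \<in> {-1<..<1}"
  define s t where "s = sqrt (1 - x\<^sup>2)" and "t = sqrt (1 - y\<^sup>2)"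
  have xm: "x \<in> {-1..1}" and ym: "y \<in> {-1..1}" using x y by (auto simp: abs_less_iff)
  have st: "s > 0" "t > 0" "s\<^sup>2 = 1 - x\<^sup>2"
    using x y by (auto simp: s_def t_def abs_square_less_1 less_imp_le)
  have u2: "1 - u\<^sup>2 > 0" and v2: "1 - v\<^sup>2 > 0"
    using u v by (simp_all add: abs_square_less_1 abs_less_iff)
  define \<rho> \<zeta> z where "\<rho> = sonine_radius x u" and "\<zeta> = sonine_point x y u v" and "z = r * \<rho>"
  define I where "I = askey_fitch_I x y r u v"
  have rho: "\<rho> > 0" "\<rho> \<le> 1" "1 - \<rho>\<^sup>2 = s\<^sup>2 * (1 - u\<^sup>2)"
    using sonine_radius[OF xm u] by (auto simp: \<rho>_def st)
  have zeta: "\<zeta> \<in> {-1..1}"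
    unfolding \<zeta>_def using v by (intro sonine_point_in xm ym u) auto
  have z: "0 < z" "z \<le> \<rho>" "z \<le> 1"
    using r rho by (auto simp: z_def mult_left_le_one_le intro: mult_le_one)
  have I_eq: "I = (1 - z)\<^sup>2 + 2 * z * (1 - \<zeta>)"
    unfolding I_def askey_fitch_I_eq[OF xm u] by (simp add: z_def \<rho>_def \<zeta>_def power2_eq_square algebra_simps)
  define A where "A = s\<^sup>2 * (1 - u\<^sup>2) / 2"
  define B where "B = u * s * t * (1 - v\<^sup>2) / 2"
  have A: "A > 0" unfolding A_def using st(1) u2 by (intro divide_pos_pos mult_pos_pos) auto
  have B: "B > 0" unfolding B_def using st(1,2) u v2 by (intro divide_pos_pos mult_pos_pos) auto
  have Iz: "I \<ge> (1 - z)\<^sup>2" using z zeta by (simp add: I_eq)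
  have zA: "1 - z \<ge> A"
  proof -
    have "1 - \<rho>\<^sup>2 = (1 - \<rho>) * (1 + \<rho>)" by (simp add: power2_eq_square algebra_simps)
    also have "\<dots> \<le> (1 - \<rho>) * 2" using rho by (intro mult_left_mono) auto
    finally show ?thesis using z rho by (simp add: A_def)
  qed
  have IA: "I \<ge> A\<^sup>2"
    using power_mono[OF zA, of 2] A Iz by simp
  have IB: "I \<ge> B"
  proof -
    \<comment> \<open>the case \<open>v = 1\<close> of \<open>\<zeta> \<le> 1\<close>\<close>
    have "\<rho> * sonine_point x y u 1 \<le> \<rho> * 1"
      using sonine_point_in[OF xm ym u, of 1] rho by (intro mult_left_mono) auto
    then have cs: "x * y + u * s * t \<le> \<rho>"
      using sonine_radius_times_point[OF xm u, of y 1] by (simp add: \<rho>_def s_def t_def)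
    have "1 - v\<^sup>2 = (1 - v) * (1 + v)" by (simp add: power2_eq_square algebra_simps)
    also have "\<dots> \<le> (1 - v) * 2" using v by (intro mult_left_mono) auto
    finally have "(u * s * t) * (1 - v\<^sup>2) \<le> (u * s * t) * ((1 - v) * 2)"
      using u st by (intro mult_left_mono) auto
    also have "(u * s * t) * ((1 - v) * 2) = 2 * (u * s * t * (1 - v))" by simp
    finally have "B \<le> u * s * t * (1 - v)" unfolding B_def by linarith
    also have "\<dots> \<le> \<rho> - \<rho> * \<zeta>"
      using cs sonine_radius_times_point[OF xm u, of y v]
      by (simp add: \<rho>_def \<zeta>_def s_def t_def algebra_simps)
    also have "\<dots> = (1/2) * \<rho> * 2 * (1 - \<zeta>)" by (simp add: algebra_simps)
    also have "\<dots> \<le> r * \<rho> * 2 * (1 - \<zeta>)"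
      using r rho zeta by (intro mult_right_mono) auto
    also have "\<dots> \<le> I" by (simp add: I_eq z_def)
    finally show ?thesis .
  qed
  have I: "I > 0" using B IB by simp
  have num: "0 \<le> 1 - z\<^sup>2" "1 - z\<^sup>2 \<le> 2 * I powr (1/2)"
  proof -
    have "1 - z\<^sup>2 = (1 - z) * (1 + z)" by (simp add: power2_eq_square algebra_simps)
    moreover have "(1 - z) * (1 + z) \<le> (1 - z) * 2" using z by (intro mult_left_mono) auto
    moreover have "1 - z \<le> sqrt I" using Iz by (rule real_le_rsqrt)
    ultimately show "1 - z\<^sup>2 \<le> 2 * I powr (1/2)" using I by (simp add: powr_half_sqrt)
    show "0 \<le> 1 - z\<^sup>2" using z by (simp add: power_le_one)
  qed
  have "\<bar>askey_fitch_integrand \<nu> x y r u v\<bar> = (1 - z\<^sup>2) / I powr (\<nu> + 1)"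
    unfolding askey_fitch_integrand_eq[OF xm u] using num I by (simp add: z_def \<rho>_def I_def)
  also have "\<dots> \<le> 2 * I powr (1/2) / I powr (\<nu> + 1)"
    using num by (intro divide_right_mono) auto
  also have "\<dots> = 2 * (I powr -p * I powr -q)"
  proof -
    have "I powr (1/2) / I powr (\<nu> + 1) = I powr (1/2 - (\<nu> + 1))" by (rule powr_diff[symmetric])
    also have "1/2 - (\<nu> + 1) = -p + -q" using pq by simp
    finally show ?thesis by (simp add: powr_add[symmetric])
  qed
  also have "\<dots> \<le> 2 * ((A\<^sup>2) powr -p * B powr -q)"
    using IA IB A B p q by (intro mult_left_mono mult_mono powr_mono2') auto
  also have "(A\<^sup>2) powr -p = (s\<^sup>2 / 2) powr (-2 * p) * (1 - u\<^sup>2) powr (-2 * p)"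
  proof -
    have "(A\<^sup>2) powr -p = A powr (2 * -p)"
      using A powr_powr[of A 2 "-p"] by simp
    also have "\<dots> = ((s\<^sup>2 / 2) * (1 - u\<^sup>2)) powr (-2 * p)" by (simp add: A_def)
    also have "\<dots> = (s\<^sup>2 / 2) powr (-2 * p) * (1 - u\<^sup>2) powr (-2 * p)"
      by (rule powr_mult)
    finally show ?thesis .
  qed
  also have "B powr -q = (s * t / 2) powr -q * u powr -q * (1 - v\<^sup>2) powr -q"
  proof -
    have "B = (s * t / 2) * u * (1 - v\<^sup>2)" by (simp add: B_def)
    then show ?thesis by (simp only: powr_mult)
  qed
  finally have "\<bar>askey_fitch_integrand \<nu> x y r u v\<bar> \<le> (2 * (s\<^sup>2 / 2) powr (-2 * p) * (s * t / 2) powr -q) *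
      (u powr -q * (1 - u\<^sup>2) powr (-2 * p)) * (1 - v\<^sup>2) powr -q"
    by (simp only: mult_ac)
  then show "askey_fitch_I x y r u v > 0 \<and> \<bar>askey_fitch_integrand \<nu> x y r u v\<bar> \<le>
      (2 * ((sqrt (1 - x\<^sup>2))\<^sup>2 / 2) powr (-2 * p) * (sqrt (1 - x\<^sup>2) * sqrt (1 - y\<^sup>2) / 2) powr -q) *
      (u powr -q * (1 - u\<^sup>2) powr (-2 * p)) * (1 - v\<^sup>2) powr -q"
    using I unfolding I_def s_def t_def by blast
qed

text \<open>
  Both sides at \<open>r = 1\<close> are limits of the two sides at \<open>R\<^sub>k = 1 - 1 / (k + 2)\<close>: the integrals by
  dominated convergence, first in \<open>v\<close> and then in \<open>u\<close>, and the series by Tannery's theorem.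
\<close>

theorem askey_fitch_boundary:
  assumes nu: "0 < \<nu>" and lam: "\<nu> + 1 < lam" and x: "\<bar>x\<bar> < 1" and y: "\<bar>y\<bar> < 1"
  shows "AE u in sonine_measure \<nu> lam.
            integrable (gegenbauer_measure (\<nu> - 1/2)) (\<lambda>v. askey_fitch_integrand \<nu> x y 1 u v)" (is ?A)
    and "integrable (sonine_measure \<nu> lam)
            (\<lambda>u. \<integral>v. askey_fitch_integrand \<nu> x y 1 u v \<partial>gegenbauer_measure (\<nu> - 1/2))" (is ?B)
    and "(\<lambda>n. gegenbauer_weight \<nu> n * ultraspherical lam n x * ultraspherical \<nu> n y) sums
            (\<integral>u. (\<integral>v. askey_fitch_integrand \<nu> x y 1 u v \<partial>gegenbauer_measure (\<nu> - 1/2))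
               \<partial>sonine_measure \<nu> lam)" (is ?C)
proof -
  let ?G = "gegenbauer_measure (\<nu> - 1/2)" and ?H = "sonine_measure \<nu> lam"
  let ?f = "askey_fitch_integrand \<nu> x y"
  let ?J = "\<lambda>r u. \<integral>v. ?f r u v \<partial>?G"
  have xm: "x \<in> {-1..1}" and ym: "y \<in> {-1..1}" using x y by (auto simp: abs_less_iff)
  have lam': "\<nu> < lam" using lam by simp
  \<comment> \<open>integrability needs \<open>2p < \<lambda> - \<nu>\<close> in \<open>u\<close> and \<open>q < \<nu>\<close> in \<open>v\<close>; as \<open>p + q = \<nu> + 1/2\<close>, this means
      \<open>1 < 2p < \<lambda> - \<nu>\<close>, so \<open>2p = 1 + e\<close> with a small \<open>e > 0\<close>; \<open>e \<le> \<nu>\<close> keeps \<open>q\<close> positive\<close>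
  define e where "e = min \<nu> ((lam - \<nu> - 1) / 2)"
  have e: "e > 0" "e \<le> \<nu>" "e < lam - \<nu> - 1" using nu lam by (auto simp: e_def min_def)
  define p q where "p = (1 + e) / 2" and "q = \<nu> - e / 2"
  have pq: "p \<ge> 0" "q \<ge> 0" "p + q = \<nu> + 1/2" using e nu by (auto simp: p_def q_def field_simps)
  obtain K where K: "\<And>r u v. r \<in> {1/2..1} \<Longrightarrow> u \<in> {0<..<1} \<Longrightarrow> v \<in> {-1<..<1} \<Longrightarrow>
     askey_fitch_I x y r u v > 0 \<and>
     \<bar>?f r u v\<bar> \<le> K * (u powr -q * (1 - u\<^sup>2) powr (-2 * p)) * (1 - v\<^sup>2) powr -q"
    using askey_fitch_majorant[OF nu x y pq] by blast
  define MH where "MH = (\<lambda>u. K * (u powr -q * (1 - u\<^sup>2) powr (-2 * p)) :: real)"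
  define MG where "MG = (\<lambda>v. (1 - v\<^sup>2) powr -q :: real)"
  have bound: "\<bar>?f r u v\<bar> \<le> MH u * MG v" and pos: "askey_fitch_I x y r u v > 0"
    if "r \<in> {1/2..1}" "u \<in> {0<..<1}" "v \<in> {-1<..<1}" for r u v
    using K[OF that] by (auto simp: MH_def MG_def)
  have MG: "integrable ?G MG"
    using has_bochner_integral_gegenbauer_measure_powr[of \<nu> "-q"] nu e
    unfolding MG_def q_def by (simp add: has_bochner_integral_iff)
  have MH: "integrable ?H MH"
  proof -
    have "has_bochner_integral ?H (\<lambda>u. u powr (2 * (-q / 2)) * (1 - u\<^sup>2) powr (-2 * p))
           (Beta (\<nu> + 1/2 + (-q / 2)) (lam - \<nu> + (-2 * p)) / Beta (\<nu> + 1/2) (lam - \<nu>))"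
      by (rule has_bochner_integral_sonine_measure_powr) (use nu lam' e in \<open>auto simp: p_def q_def field_simps\<close>)
    then show ?thesis unfolding MH_def by (simp add: has_bochner_integral_iff)
  qed
  have intf: "integrable ?G (?f r u)" if "r \<in> {1/2..1}" "u \<in> {0<..<1}" for r u
  proof (rule Bochner_Integration.integrable_bound)
    show "integrable ?G (\<lambda>v. MH u * MG v)" using MG by simp
    show "AE v in ?G. norm (?f r u v) \<le> norm (MH u * MG v)"
      using AE_gegenbauer_measure
    proof eventually_elim
      case (elim v)
      show ?case using bound[OF that elim] by simp
    qed
  qed measurable
  show ?A using AE_sonine_measure by eventually_elim (rule intf, auto)
  define R where "R = (\<lambda>k. 1 - 1 / (real k + 2))"
  have R: "R k \<in> {1/2..1}" "\<bar>R k\<bar> < 1" for k by (auto simp: R_def field_simps abs_less_iff)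
  have Rlim: "R \<longlonglongrightarrow> 1" unfolding R_def by real_asymp
  have Jlim: "(\<lambda>k. ?J (R k) u) \<longlonglongrightarrow> ?J 1 u" if u: "u \<in> {0<..<1}" for u
  proof (rule integral_dominated_convergence)
    show "integrable ?G (\<lambda>v. MH u * MG v)" using MG by simp
    show "AE v in ?G. (\<lambda>k. ?f (R k) u v) \<longlonglongrightarrow> ?f 1 u v"
      using AE_gegenbauer_measure
    proof eventually_elim
      case (elim v)
      have I1: "askey_fitch_I x y 1 u v \<noteq> 0" using pos[OF _ u elim, of 1] by simp
      have "(\<lambda>k. askey_fitch_I x y (R k) u v) \<longlonglongrightarrow> askey_fitch_I x y 1 u v"
        unfolding askey_fitch_I_def by (intro tendsto_intros Rlim)
      then show ?case
        unfolding askey_fitch_integrand_def using I1 by (intro tendsto_intros Rlim) auto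
    qed
    show "AE v in ?G. norm (?f (R k) u v) \<le> MH u * MG v" for k
      using AE_gegenbauer_measure
    proof eventually_elim
      case (elim v)
      show ?case using bound[OF R(1) u elim] by simp
    qed
  qed measurable
  define c where "c = (\<integral>v. MG v \<partial>?G)"
  have Jbound: "\<bar>?J r u\<bar> \<le> MH u * c" if "r \<in> {1/2..1}" "u \<in> {0<..<1}" for r u
  proof -
    have "\<bar>?J r u\<bar> \<le> (\<integral>v. \<bar>?f r u v\<bar> \<partial>?G)" by (rule integral_abs_bound)
    also have "\<dots> \<le> (\<integral>v. MH u * MG v \<partial>?G)"
    proof (rule integral_mono_AE)
      show "AE v in ?G. \<bar>?f r u v\<bar> \<le> MH u * MG v"
        using AE_gegenbauer_measure by eventually_elim (rule bound[OF that])
    qed (use intf[OF that] MG in auto)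
    finally show ?thesis by (simp add: c_def)
  qed
  have Jm: "?J r \<in> borel_measurable ?H" for r by (rule borel_measurable_askey_fitch_inner[OF nu])
  have MHc: "integrable ?H (\<lambda>u. MH u * c)" using MH by simp
  show ?B
  proof (rule Bochner_Integration.integrable_bound[OF MHc Jm])
    show "AE u in ?H. norm (?J 1 u) \<le> norm (MH u * c)"
      using AE_sonine_measure
    proof eventually_elim
      case (elim u)
      show ?case using Jbound[OF _ elim, of 1] by simp
    qed
  qed
  have lim1: "(\<lambda>k. \<integral>u. ?J (R k) u \<partial>?H) \<longlonglongrightarrow> (\<integral>u. ?J 1 u \<partial>?H)"
  proof (rule integral_dominated_convergence[OF Jm Jm MHc])
    show "AE u in ?H. (\<lambda>k. ?J (R k) u) \<longlonglongrightarrow> ?J 1 u"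
      using AE_sonine_measure by eventually_elim (rule Jlim)
    show "AE u in ?H. norm (?J (R k) u) \<le> MH u * c" for k
      using AE_sonine_measure
    proof eventually_elim
      case (elim u)
      show ?case using Jbound[OF R(1) elim] by simp
    qed
  qed
  define a where "a = (\<lambda>n. gegenbauer_weight \<nu> n * ultraspherical lam n x * ultraspherical \<nu> n y)"
  have suma: "summable (\<lambda>n. \<bar>a n\<bar>)"
    unfolding a_def by (rule summable_askey_fitch_boundary[OF nu lam x y])
  have eqR: "(\<integral>u. ?J (R k) u \<partial>?H) = (\<Sum>n. a n * R k ^ n)" for k
    using askey_fitch_inside(3)[OF nu lam' xm ym R(2), of k]
    by (simp add: sums_iff a_def mult_ac)
  have "(\<lambda>k. \<Sum>n. a n * R k ^ n) \<longlonglongrightarrow> suminf a"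
  proof (rule tannerys_theorem[THEN conjunct2, THEN conjunct2])
    show "(\<lambda>k. a n * R k ^ n) \<longlonglongrightarrow> a n" for n
      using tendsto_mult_left[OF tendsto_power[OF Rlim, of n], of "a n"] by simp
    have "norm (a n * R k ^ n) \<le> \<bar>a n\<bar>" for n k
      using R[of k] by (auto simp: abs_mult power_abs intro!: mult_right_le_one_le power_le_one)
    then show "eventually (\<lambda>(n, k). norm (a n * R k ^ n) \<le> \<bar>a n\<bar>) (at_top \<times>\<^sub>F sequentially)"
      by (intro always_eventually) auto
  qed (use suma in auto)
  then have "suminf a = (\<integral>u. ?J 1 u \<partial>?H)"
    using lim1 unfolding eqR by (rule LIMSEQ_unique)
  moreover have "a sums suminf a"
    by (rule summable_sums[OF summable_rabs_cancel[OF suma]])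
  ultimately show ?C by (simp add: a_def)
qed

theorem theorem3p1:
  fixes \<nu> lam x y r :: real
  assumes "0 < \<nu>" and "\<nu> < lam" and "x \<in> {-1..1}" and "y \<in> {-1..1}"
    and "r \<in> {-1<..<1} \<or>
         (r = 1 \<and> x \<in> {-1<..<1} \<and> y \<in> {-1<..<1} \<and> \<not> (\<nu> < lam \<and> lam \<le> \<nu> + 1))"
  shows "(AE u in sonine_measure \<nu> lam.
            integrable (gegenbauer_measure (\<nu> - 1/2)) (\<lambda>v. askey_fitch_integrand \<nu> x y r u v)) \<and>
         integrable (sonine_measure \<nu> lam)
            (\<lambda>u. \<integral>v. askey_fitch_integrand \<nu> x y r u v \<partial>gegenbauer_measure (\<nu> - 1/2)) \<and>
         (\<lambda>n. gegenbauer_weight \<nu> n * r ^ n * ultraspherical lam n x * ultraspherical \<nu> n y) sums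
            (\<integral>u. (\<integral>v. askey_fitch_integrand \<nu> x y r u v \<partial>gegenbauer_measure (\<nu> - 1/2))
               \<partial>sonine_measure \<nu> lam)"
  using assms(5)
proof
  assume "r \<in> {-1<..<1}"
  then have "\<bar>r\<bar> < 1" by (simp add: abs_less_iff)
  from askey_fitch_inside[OF assms(1-4) this] show ?thesis by blast
next
  assume r: "r = 1 \<and> x \<in> {-1<..<1} \<and> y \<in> {-1<..<1} \<and> \<not> (\<nu> < lam \<and> lam \<le> \<nu> + 1)"
  then have "\<bar>x\<bar> < 1" "\<bar>y\<bar> < 1" "\<nu> + 1 < lam" using assms(2) by (auto simp: abs_less_iff)
  from askey_fitch_boundary[OF assms(1) this(3,1,2)] r show ?thesis by simp
qed

end
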